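(* Let $p:\mathcal{T}\to\mathcal{B}$ be a Waldhausen opfibration. If the basis category $\mathcal{B}$ is a Waldhausen category, then the class of total cofibrations and the class of total weak equivalences endow the total category $\mathcal{T}$ with a Waldhausen category structure. Here a total cofibration (resp., total weak equivalence) is a morphism $f:X\to Y$ in $\mathcal{T}$ such that $u=p(f):A\to B$ is a cofibration (resp., weak equivalence) in $\mathcal{B}$ and the induced morphism $f_\triangleright:u_!(X)\to Y$ is a cofibration (resp., weak equivalence) in the fiber $\mathcal{T}_B$.
   Context: Waldhausen category (no zero object is required): a category $\mathsf{E}$ with an initial object $0$ together with a Waldhausen structure, that is, a class $\mathsf{C}$ of morphisms called cofibrations (denoted $\rightarrowtail$) and a class $\mathsf{W}$ of morphisms called weak equivalences, both closed under composition, such that: (C1) all isomorphisms are cofibrations; (C2) for every object $A$ the morphism $0\to A$ is a cofibration; (C3) if $A\rightarrowtail B$ is a cofibration, then for any morphism $A\to C$ the pushout $B\sqcup_A C$ exists and $C\to B\sqcup_A C$ is a cofibration; (W1) all isomorphisms are weak equivalences; (W2) (Gluing Lemma) given a commutative diagram with rows $C\leftarrow A\rightarrowtail B$ and $C'\leftarrow A'\rightarrowtail B'$ (the right-hand horizontal morphisms being cofibrations) and vertical morphisms $C\to C'$, $A\to A'$, $B\to B'$ that are weak equivalences, the induced morphism $B\sqcup_A C\to B'\sqcup_{A'}C'$ is a weak equivalence. A functor between Waldhausen categories is exact if it preserves initial objects, cofibrations, weak equivalences, and the pushout diagrams of (C3). Grothendieck opfibrations: let $p:\mathcal{T}\to\mathcal{B}$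 be a functor. The fiber $\mathcal{T}_A$ of an object $A$ of $\mathcal{B}$ is the subcategory of $\mathcal{T}$ with objects $X$ such that $p(X)=A$ and morphisms $f$ such that $p(f)=\mathrm{id}_A$. An object $X$ (morphism $f$) of $\mathcal{T}$ is above $p(X)$ (resp. $p(f)$). A morphism $f:X\to Y$ above $u:A\to B$ is cocartesian if for every $v:B\to C$ in $\mathcal{B}$ and every $g:X\to Z$ above $v\circ u$ there is a unique $h:Y\to Z$ above $v$ with $h\circ f=g$. A (cloven) Grothendieck opfibration is a functor $p:\mathcal{T}\to\mathcal{B}$ together with, for every object $X$ of $\mathcal{T}$ above $A$ and every morphism $u:A\to B$ in $\mathcal{B}$, a chosen object $u_!(X)$ and a chosen cocartesian morphism $\lambda_{u,X}:X\to u_!(X)$ above $u$. For $f:X\to Y$ above $u:A\to B$, $f_\triangleright:u_!(X)\to Y$ denotes the unique morphism in $\mathcal{T}_B$ with $f=f_\triangleright\circ\lambda_{u,X}$. The reindexing functor $u_!:\mathcal{T}_A\to\mathcal{T}_B$ sends $X$ to $u_!(X)$ and $k:X\to X'$ to $(\lambda_{u,X'}\circ k)_\triangleright$. A Waldhausen opfibration is a Grothendieck opfibration $p:\mathcal{T}\to\mathcal{B}$ such that each fiber $\mathcal{T}_A$ ($A$ an object of $\mathcal{B}$) is a Waldhausen category and, for each morphism $u:A\to B$ in $\mathcal{B}$, the reindexing functor $u_!:\mathcal{T}_A\to\mathcal{T}_B$ is exact. *)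

theory Defs
  imports Main
begin

section \<open>Categories and functors\<close>

record ('o, 'm) cat =
  Ob  :: "'o set"
  Mor :: "'m set"
  Dom :: "'m \<Rightarrow> 'o"
  Cod :: "'m \<Rightarrow> 'o"
  Id  :: "'o \<Rightarrow> 'm"
  Comp :: "'m \<Rightarrow> 'm \<Rightarrow> 'm"  (infixr "\<cdot>\<index>" 70)

text \<open>Composition is written in the order \<open>g \<cdot> f\<close> (first \<open>f\<close>, then \<open>g\<close>).
  Nothing is assumed about the operations outside \<open>Ob\<close> and \<open>Mor\<close>.\<close>

definition hom :: "('o, 'm) cat \<Rightarrow> 'o \<Rightarrow> 'o \<Rightarrow> 'm set" where
  "hom C X Y = {f \<in> Mor C. Dom C f = X \<and> Cod C f = Y}"

locale category =
  fixes C :: "('o, 'm) cat" (structure)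
  assumes dom_in_Ob: "f \<in> Mor C \<Longrightarrow> Dom C f \<in> Ob C"
    and cod_in_Ob: "f \<in> Mor C \<Longrightarrow> Cod C f \<in> Ob C"
    and id_in_hom: "X \<in> Ob C \<Longrightarrow> Id C X \<in> hom C X X"
    and comp_in_hom: "f \<in> hom C X Y \<Longrightarrow> g \<in> hom C Y Z \<Longrightarrow> g \<cdot> f \<in> hom C X Z"
    and comp_id_right: "f \<in> Mor C \<Longrightarrow> f \<cdot> Id C (Dom C f) = f"
    and comp_id_left: "f \<in> Mor C \<Longrightarrow> Id C (Cod C f) \<cdot> f = f"
    and comp_assoc: "f \<in> hom C X Y \<Longrightarrow> g \<in> hom C Y Z \<Longrightarrow> h \<in> hom C Z W \<Longrightarrow>
                       (h \<cdot> g) \<cdot> f = h \<cdot> (g \<cdot> f)"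

definition is_iso :: "('o, 'm) cat \<Rightarrow> 'm \<Rightarrow> bool" where
  "is_iso C f \<longleftrightarrow> f \<in> Mor C \<and>
     (\<exists>g \<in> hom C (Cod C f) (Dom C f).
        g \<cdot>\<^bsub>C\<^esub> f = Id C (Dom C f) \<and> f \<cdot>\<^bsub>C\<^esub> g = Id C (Cod C f))"

definition is_initial :: "('o, 'm) cat \<Rightarrow> 'o \<Rightarrow> bool" where
  "is_initial C z \<longleftrightarrow> z \<in> Ob C \<and> (\<forall>X \<in> Ob C. \<exists>!f. f \<in> hom C z X)"

text \<open>\<open>is_pushout C i f j k\<close>: the square with \<open>i : A \<rightarrow> B\<close>, \<open>f : A \<rightarrow> C\<close>, \<open>j : B \<rightarrow> P\<close>,
  \<open>k : C \<rightarrow> P\<close> is a pushout square.\<close>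

definition is_pushout :: "('o, 'm) cat \<Rightarrow> 'm \<Rightarrow> 'm \<Rightarrow> 'm \<Rightarrow> 'm \<Rightarrow> bool" where
  "is_pushout C i f j k \<longleftrightarrow>
     i \<in> Mor C \<and> f \<in> Mor C \<and> Dom C i = Dom C f \<and>
     j \<in> hom C (Cod C i) (Cod C j) \<and> k \<in> hom C (Cod C f) (Cod C j) \<and>
     j \<cdot>\<^bsub>C\<^esub> i = k \<cdot>\<^bsub>C\<^esub> f \<and>
     (\<forall>Q \<in> Ob C. \<forall>j' \<in> hom C (Cod C i) Q. \<forall>k' \<in> hom C (Cod C f) Q.
        j' \<cdot>\<^bsub>C\<^esub> i = k' \<cdot>\<^bsub>C\<^esub> f \<longrightarrow>
        (\<exists>!h. h \<in> hom C (Cod C j) Q \<and> h \<cdot>\<^bsub>C\<^esub> j = j' \<and> h \<cdot>\<^bsub>C\<^esub> k = k'))"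

record ('o1, 'm1, 'o2, 'm2) functor_data =
  on_Ob  :: "'o1 \<Rightarrow> 'o2"
  on_Mor :: "'m1 \<Rightarrow> 'm2"

locale is_functor =
  source: category C + target: category D
  for C :: "('o1, 'm1) cat" and D :: "('o2, 'm2) cat" +
  fixes F :: "('o1, 'm1, 'o2, 'm2) functor_data"
  assumes map_Ob: "X \<in> Ob C \<Longrightarrow> on_Ob F X \<in> Ob D"
    and map_hom: "f \<in> hom C X Y \<Longrightarrow> on_Mor F f \<in> hom D (on_Ob F X) (on_Ob F Y)"
    and map_id: "X \<in> Ob C \<Longrightarrow> on_Mor F (Id C X) = Id D (on_Ob F X)"
    and map_comp: "f \<in> hom C X Y \<Longrightarrow> g \<in> hom C Y Z \<Longrightarrow>
                     on_Mor F (g \<cdot>\<^bsub>C\<^esub> f) = on_Mor F g \<cdot>\<^bsub>D\<^esub> on_Mor F f"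

section \<open>Waldhausen categories and exact functors\<close>

text \<open>Pushouts are not chosen: gluing is required for all pushout squares of the two spans,
  and the induced morphism \<open>h\<close> is identified by its two defining equations.\<close>

locale waldhausen_category = category C
  for C :: "('o, 'm) cat" (structure) +
  fixes cof :: "'m set" and weq :: "'m set"
  assumes cof_subset: "cof \<subseteq> Mor C"
    and weq_subset: "weq \<subseteq> Mor C"
    and cof_comp: "f \<in> cof \<Longrightarrow> g \<in> cof \<Longrightarrow> Dom C g = Cod C f \<Longrightarrow> g \<cdot> f \<in> cof"
    and weq_comp: "f \<in> weq \<Longrightarrow> g \<in> weq \<Longrightarrow> Dom C g = Cod C f \<Longrightarrow> g \<cdot> f \<in> weq"
    and cof_iso: "is_iso C f \<Longrightarrow> f \<in> cof"
    and cof_initial: "\<exists>z. is_initial C z \<and> (\<forall>A \<in> Ob C. \<forall>f \<in> hom C z A. f \<in> cof)"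
    and cof_pushout: "i \<in> cof \<Longrightarrow> f \<in> Mor C \<Longrightarrow> Dom C f = Dom C i \<Longrightarrow>
                        \<exists>j k. is_pushout C i f j k \<and> k \<in> cof"
    and weq_iso: "is_iso C f \<Longrightarrow> f \<in> weq"
    and gluing: "i \<in> cof \<Longrightarrow> i' \<in> cof \<Longrightarrow>
                 is_pushout C i f j k \<Longrightarrow> is_pushout C i' f' j' k' \<Longrightarrow>
                 a \<in> weq \<Longrightarrow> b \<in> weq \<Longrightarrow> c \<in> weq \<Longrightarrow>
                 a \<in> hom C (Dom C i) (Dom C i') \<Longrightarrow>
                 b \<in> hom C (Cod C i) (Cod C i') \<Longrightarrow>
                 c \<in> hom C (Cod C f) (Cod C f') \<Longrightarrow>
                 b \<cdot> i = i' \<cdot> a \<Longrightarrow> c \<cdot> f = f' \<cdot> a \<Longrightarrow>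
                 h \<in> hom C (Cod C j) (Cod C j') \<Longrightarrow>
                 h \<cdot> j = j' \<cdot> b \<Longrightarrow> h \<cdot> k = k' \<cdot> c \<Longrightarrow> h \<in> weq"

locale exact_functor =
  is_functor C D F + source: waldhausen_category C cofC weqC + target: waldhausen_category D cofD weqD
  for C :: "('o1, 'm1) cat" and cofC weqC
    and D :: "('o2, 'm2) cat" and cofD weqD
    and F :: "('o1, 'm1, 'o2, 'm2) functor_data" +
  assumes preserves_initial: "is_initial C z \<Longrightarrow> is_initial D (on_Ob F z)"
    and preserves_cof: "f \<in> cofC \<Longrightarrow> on_Mor F f \<in> cofD"
    and preserves_weq: "f \<in> weqC \<Longrightarrow> on_Mor F f \<in> weqD"
    and preserves_pushout: "i \<in> cofC \<Longrightarrow> is_pushout C i f j k \<Longrightarrow>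
          is_pushout D (on_Mor F i) (on_Mor F f) (on_Mor F j) (on_Mor F k)"

section \<open>Grothendieck opfibrations\<close>

definition fiber ::
  "('o, 'm) cat \<Rightarrow> ('a, 'b) cat \<Rightarrow> ('o, 'm, 'a, 'b) functor_data \<Rightarrow> 'a \<Rightarrow> ('o, 'm) cat" where
  "fiber T B p A =
     \<lparr>Ob = {X \<in> Ob T. on_Ob p X = A}, Mor = {f \<in> Mor T. on_Mor p f = Id B A},
      Dom = Dom T, Cod = Cod T, Id = Id T, Comp = Comp T\<rparr>"

definition is_cocartesian ::
  "('o, 'm) cat \<Rightarrow> ('a, 'b) cat \<Rightarrow> ('o, 'm, 'a, 'b) functor_data \<Rightarrow> 'm \<Rightarrow> bool" where
  "is_cocartesian T B p f \<longleftrightarrow> f \<in> Mor T \<and>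
     (\<forall>v \<in> Mor B. \<forall>g \<in> Mor T.
        Dom B v = Cod B (on_Mor p f) \<longrightarrow> Dom T g = Dom T f \<longrightarrow>
        on_Mor p g = v \<cdot>\<^bsub>B\<^esub> on_Mor p f \<longrightarrow>
        (\<exists>!h. h \<in> hom T (Cod T f) (Cod T g) \<and> on_Mor p h = v \<and> h \<cdot>\<^bsub>T\<^esub> f = g))"

text \<open>The cleavage consists of the objects \<open>push u X\<close> (written $u_!(X)$ in the literature) and
  the morphisms \<open>lift u X : X \<rightarrow> push u X\<close>; only the values with \<open>X\<close> above \<open>Dom B u\<close> matter.\<close>

locale grothendieck_opfibration = is_functor T B p
  for T :: "('o, 'm) cat" and B :: "('a, 'b) cat" and p :: "('o, 'm, 'a, 'b) functor_data" +
  fixes push :: "'b \<Rightarrow> 'o \<Rightarrow> 'o" and lift :: "'b \<Rightarrow> 'o \<Rightarrow> 'm"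
  assumes lift_in_hom: "u \<in> Mor B \<Longrightarrow> X \<in> Ob T \<Longrightarrow> on_Ob p X = Dom B u \<Longrightarrow>
                          lift u X \<in> hom T X (push u X)"
    and lift_above: "u \<in> Mor B \<Longrightarrow> X \<in> Ob T \<Longrightarrow> on_Ob p X = Dom B u \<Longrightarrow>
                       on_Mor p (lift u X) = u"
    and lift_cocartesian: "u \<in> Mor B \<Longrightarrow> X \<in> Ob T \<Longrightarrow> on_Ob p X = Dom B u \<Longrightarrow>
                             is_cocartesian T B p (lift u X)"

text \<open>\<open>induced T B p push lift f\<close> is the morphism \<open>f\<^sub>\<triangleright> : push u X \<rightarrow> Y\<close> of the fiber above
  the codomain of \<open>u = p f\<close>, for \<open>f : X \<rightarrow> Y\<close>.\<close>

definition induced ::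
  "('o, 'm) cat \<Rightarrow> ('a, 'b) cat \<Rightarrow> ('o, 'm, 'a, 'b) functor_data \<Rightarrow>
     ('b \<Rightarrow> 'o \<Rightarrow> 'o) \<Rightarrow> ('b \<Rightarrow> 'o \<Rightarrow> 'm) \<Rightarrow> 'm \<Rightarrow> 'm" where
  "induced T B p push lift f =
     (let u = on_Mor p f; X = Dom T f in
      THE h. h \<in> hom (fiber T B p (Cod B u)) (push u X) (Cod T f) \<and> h \<cdot>\<^bsub>T\<^esub> lift u X = f)"

definition reindex ::
  "('o, 'm) cat \<Rightarrow> ('a, 'b) cat \<Rightarrow> ('o, 'm, 'a, 'b) functor_data \<Rightarrow>
     ('b \<Rightarrow> 'o \<Rightarrow> 'o) \<Rightarrow> ('b \<Rightarrow> 'o \<Rightarrow> 'm) \<Rightarrow> 'b \<Rightarrow> ('o, 'm, 'o, 'm) functor_data" where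
  "reindex T B p push lift u =
     \<lparr>on_Ob = push u,
      on_Mor = (\<lambda>k. induced T B p push lift (lift u (Cod T k) \<cdot>\<^bsub>T\<^esub> k))\<rparr>"

text \<open>The definite description in \<open>induced\<close> is always well-defined.\<close>

lemma (in grothendieck_opfibration) ex1_induced:
  assumes f: "f \<in> Mor T"
  shows "\<exists>!h. h \<in> hom (fiber T B p (Cod B (on_Mor p f))) (push (on_Mor p f) (Dom T f)) (Cod T f) \<and>
              h \<cdot>\<^bsub>T\<^esub> lift (on_Mor p f) (Dom T f) = f"
proof -
  let ?u = "on_Mor p f" and ?X = "Dom T f"
  have u: "?u \<in> hom B (on_Ob p ?X) (on_Ob p (Cod T f))"
    using f map_hom[of f ?X "Cod T f"] by (simp add: hom_def)
  then have uM: "?u \<in> Mor B" and uD: "on_Ob p ?X = Dom B ?u" by (auto simp: hom_def)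
  have X: "?X \<in> Ob T" using f source.dom_in_Ob by simp
  note l = lift_in_hom[OF uM X uD] lift_above[OF uM X uD] lift_cocartesian[OF uM X uD]
  have i: "Id B (Cod B ?u) \<in> hom B (Cod B ?u) (Cod B ?u)"
    using uM target.cod_in_Ob target.id_in_hom by simp
  have "\<exists>!h. h \<in> hom T (Cod T (lift ?u ?X)) (Cod T f) \<and> on_Mor p h = Id B (Cod B ?u) \<and>
             h \<cdot>\<^bsub>T\<^esub> lift ?u ?X = f"
    using l i f uM target.comp_id_left[OF uM] unfolding is_cocartesian_def
    by (auto simp: hom_def)
  moreover have "Cod T (lift ?u ?X) = push ?u ?X" using l(1) by (simp add: hom_def)
  ultimately show ?thesis by (simp add: hom_def fiber_def conj_ac)
qed

section \<open>Waldhausen opfibrations\<close>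

text \<open>\<open>cof A\<close> and \<open>weq A\<close> are the cofibrations and weak equivalences of the fiber above \<open>A\<close>.\<close>

locale waldhausen_opfibration = grothendieck_opfibration T B p push lift
  for T :: "('o, 'm) cat" and B :: "('a, 'b) cat" and p :: "('o, 'm, 'a, 'b) functor_data"
    and push :: "'b \<Rightarrow> 'o \<Rightarrow> 'o" and lift :: "'b \<Rightarrow> 'o \<Rightarrow> 'm" +
  fixes cof :: "'a \<Rightarrow> 'm set" and weq :: "'a \<Rightarrow> 'm set"
  assumes fiber_waldhausen: "A \<in> Ob B \<Longrightarrow> waldhausen_category (fiber T B p A) (cof A) (weq A)"
    and reindex_exact: "u \<in> Mor B \<Longrightarrow>
          exact_functor (fiber T B p (Dom B u)) (cof (Dom B u)) (weq (Dom B u))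
                        (fiber T B p (Cod B u)) (cof (Cod B u)) (weq (Cod B u))
                        (reindex T B p push lift u)"

text \<open>With the classes of cofibrations (weak equivalences) of the basis and of the fibers as last two
  arguments, \<open>total_class\<close> is the class of total cofibrations (total weak equivalences).\<close>

definition total_class ::
  "('o, 'm) cat \<Rightarrow> ('a, 'b) cat \<Rightarrow> ('o, 'm, 'a, 'b) functor_data \<Rightarrow>
     ('b \<Rightarrow> 'o \<Rightarrow> 'o) \<Rightarrow> ('b \<Rightarrow> 'o \<Rightarrow> 'm) \<Rightarrow> 'b set \<Rightarrow> ('a \<Rightarrow> 'm set) \<Rightarrow> 'm set" where
  "total_class T B p push lift base_class fiber_class =
     {f \<in> Mor T. on_Mor p f \<in> base_class \<and>
                 induced T B p push lift f \<in> fiber_class (Cod B (on_Mor p f))}"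

end

(* A cocartesian arrow over u followed by a fiber morphism h lies in a total class as soon as u is
   in the base class and h in the fiber class, whichever cocartesian arrow is chosen; so the
   closure properties reduce to composing and comparing cocartesian arrows. Since the reindexing
   functors preserve pushouts along cofibrations, such a pushout in a fiber is already a pushout in
   the total category. Hence the pushout of Z <- X >-> Y is obtained by forming the pushout P of the
   images in the basis, transporting the span to the fiber over P along cocartesian arrows, and
   taking the pushout there. For the gluing lemma it suffices to treat pushouts of this form, as
   weak equivalences are closed under composition with isomorphisms: the image w of the induced
   morphism is a weak equivalence by gluing in the basis, and reindexing along w reduces the fiber
   part to gluing in the fiber over the codomain of w. *)

theory Submission
  imports Defs
begin

section \<open>Isomorphisms, pushouts and initial objects in a single category\<close>

context category
begin

lemma Mor_in_hom: "f \<in> Mor C \<Longrightarrow> f \<in> hom C (Dom C f) (Cod C f)"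
  by (simp add: hom_def)

lemma comp_simps [simp]:
  assumes "f \<in> Mor C" "g \<in> Mor C" "Dom C g = Cod C f"
  shows "g \<cdot> f \<in> Mor C" "Dom C (g \<cdot> f) = Dom C f" "Cod C (g \<cdot> f) = Cod C g"
  using comp_in_hom[of f "Dom C f" "Cod C f" g "Cod C g"] assms by (auto simp: hom_def)

lemma assoc:
  assumes "f \<in> Mor C" "g \<in> Mor C" "h \<in> Mor C" "Dom C g = Cod C f" "Dom C h = Cod C g"
  shows "(h \<cdot> g) \<cdot> f = h \<cdot> g \<cdot> f"
  using comp_assoc[of f "Dom C f" "Cod C f" g "Cod C g" h "Cod C h"] assms
  by (simp add: hom_def)

lemma id_simps [simp]:
  assumes "X \<in> Ob C"
  shows "Id C X \<in> Mor C" "Dom C (Id C X) = X" "Cod C (Id C X) = X"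
  using id_in_hom[OF assms] by (auto simp: hom_def)

lemma id_left [simp]: "f \<in> Mor C \<Longrightarrow> Cod C f = X \<Longrightarrow> Id C X \<cdot> f = f"
  using comp_id_left by blast

lemma id_right [simp]: "f \<in> Mor C \<Longrightarrow> Dom C f = X \<Longrightarrow> f \<cdot> Id C X = f"
  using comp_id_right by blast

lemma is_isoI:
  assumes "f \<in> hom C X Y" "g \<in> hom C Y X" "g \<cdot> f = Id C X" "f \<cdot> g = Id C Y"
  shows "is_iso C f"
  using assms unfolding is_iso_def hom_def by auto

lemma is_isoE:
  assumes "is_iso C f" "f \<in> hom C X Y"
  obtains g where "g \<in> hom C Y X" "g \<cdot> f = Id C X" "f \<cdot> g = Id C Y" "is_iso C g"
proof -
  obtain g where g: "g \<in> hom C Y X" "g \<cdot> f = Id C X" "f \<cdot> g = Id C Y"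
    using assms unfolding is_iso_def hom_def by auto
  with is_isoI[OF g(1) assms(2)] that show thesis by blast
qed

text \<open>The composites of \<open>h'\<close> with the two legs form a cocone which both arrows
  mediate. The uniqueness half of the universal property thus becomes a cancellation rule for the
  pair \<open>(j, k)\<close>.\<close>

lemma pushout_unique_arrow:
  assumes po: "is_pushout C i f j k"
    and h: "h \<in> hom C (Cod C j) Q" and h': "h' \<in> hom C (Cod C j) Q"
    and eq: "h \<cdot> j = h' \<cdot> j" "h \<cdot> k = h' \<cdot> k"
  shows "h = h'"
proof -
  have m: "i \<in> Mor C" "f \<in> Mor C" "Dom C i = Dom C f" "j \<in> Mor C" "k \<in> Mor C"
    "Dom C j = Cod C i" "Dom C k = Cod C f" "Cod C k = Cod C j" "j \<cdot> i = k \<cdot> f"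
    using po by (auto simp: is_pushout_def hom_def)
  have hm: "h' \<in> Mor C" "Dom C h' = Cod C j" "Cod C h' = Q" "Q \<in> Ob C"
    using h' cod_in_Ob by (auto simp: hom_def)
  have "(h' \<cdot> j) \<cdot> i = (h' \<cdot> k) \<cdot> f"
    using m hm by (simp add: assoc)
  moreover have "h' \<cdot> j \<in> hom C (Cod C i) Q" "h' \<cdot> k \<in> hom C (Cod C f) Q"
    using m hm by (auto simp: hom_def)
  ultimately have "\<exists>!x. x \<in> hom C (Cod C j) Q \<and> x \<cdot> j = h' \<cdot> j \<and> x \<cdot> k = h' \<cdot> k"
    using po hm unfolding is_pushout_def by blast
  then show ?thesis using h h' eq by blast
qed

lemma pushout_universal:
  assumes "is_pushout C i f j k" "j' \<in> hom C (Cod C i) Q" "k' \<in> hom C (Cod C f) Q"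
    "j' \<cdot> i = k' \<cdot> f"
  obtains h where "h \<in> hom C (Cod C j) Q" "h \<cdot> j = j'" "h \<cdot> k = k'"
proof -
  have "Q \<in> Ob C" using assms(2) cod_in_Ob by (auto simp: hom_def)
  then have "\<exists>!h. h \<in> hom C (Cod C j) Q \<and> h \<cdot> j = j' \<and> h \<cdot> k = k'"
    using assms unfolding is_pushout_def by blast
  then show thesis using that by blast
qed

text \<open>The mediating arrows in the two directions compose to arrows fixing both legs, hence to
  identities. This allows an arbitrary pushout square to be replaced by a constructed one.\<close>

lemma pushout_comparison:
  assumes po: "is_pushout C i f j k" and po': "is_pushout C i f j' k'"
  obtains s t where "s \<in> hom C (Cod C j) (Cod C j')" "s \<cdot> j = j'" "s \<cdot> k = k'"
    "t \<in> hom C (Cod C j') (Cod C j)" "t \<cdot> j' = j" "t \<cdot> k' = k"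
    "t \<cdot> s = Id C (Cod C j)" "s \<cdot> t = Id C (Cod C j')"
proof -
  have m: "j \<in> hom C (Cod C i) (Cod C j)" "k \<in> hom C (Cod C f) (Cod C j)" "j \<cdot> i = k \<cdot> f"
    and m': "j' \<in> hom C (Cod C i) (Cod C j')" "k' \<in> hom C (Cod C f) (Cod C j')" "j' \<cdot> i = k' \<cdot> f"
    using po po' by (auto simp: is_pushout_def)
  obtain s where s: "s \<in> hom C (Cod C j) (Cod C j')" "s \<cdot> j = j'" "s \<cdot> k = k'"
    using pushout_universal[OF po m'] .
  obtain t where t: "t \<in> hom C (Cod C j') (Cod C j)" "t \<cdot> j' = j" "t \<cdot> k' = k"
    using pushout_universal[OF po' m] .
  have ob: "Cod C j \<in> Ob C" "Cod C j' \<in> Ob C"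
    using m m' cod_in_Ob by (auto simp: hom_def)
  have "t \<cdot> s = Id C (Cod C j)"
    by (rule pushout_unique_arrow[OF po]) (use s t m m' ob in \<open>auto simp: hom_def assoc\<close>)
  moreover have "s \<cdot> t = Id C (Cod C j')"
    by (rule pushout_unique_arrow[OF po']) (use s t m m' ob in \<open>auto simp: hom_def assoc\<close>)
  ultimately show thesis using that s t by blast
qed

text \<open>Existence and cancellation are separated because in the total category each half needs
  its own application of cocartesianness.\<close>

lemma is_pushoutI:
  assumes "i \<in> hom C X Y" "f \<in> hom C X Z" "j \<in> hom C Y P" "k \<in> hom C Z P" "j \<cdot> i = k \<cdot> f"
    and "\<And>Q j' k'. j' \<in> hom C Y Q \<Longrightarrow> k' \<in> hom C Z Q \<Longrightarrow> j' \<cdot> i = k' \<cdot> f \<Longrightarrow>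
           \<exists>h. h \<in> hom C P Q \<and> h \<cdot> j = j' \<and> h \<cdot> k = k'"
    and "\<And>Q h h'. h \<in> hom C P Q \<Longrightarrow> h' \<in> hom C P Q \<Longrightarrow> h \<cdot> j = h' \<cdot> j \<Longrightarrow> h \<cdot> k = h' \<cdot> k \<Longrightarrow> h = h'"
  shows "is_pushout C i f j k"
proof -
  have D: "i \<in> Mor C" "f \<in> Mor C" "Dom C i = Dom C f" "Cod C i = Y" "Cod C f = Z" "Cod C j = P"
    using assms(1-3) by (auto simp: hom_def)
  have "\<exists>!h. h \<in> hom C P Q \<and> h \<cdot> j = j' \<and> h \<cdot> k = k'"
    if jk: "j' \<in> hom C Y Q" "k' \<in> hom C Z Q" "j' \<cdot> i = k' \<cdot> f" for Q j' k'
  proof -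
    obtain h where h: "h \<in> hom C P Q" "h \<cdot> j = j'" "h \<cdot> k = k'" using assms(6)[OF jk] by blast
    show ?thesis
    proof (rule ex1I)
      show "h' = h" if "h' \<in> hom C P Q \<and> h' \<cdot> j = j' \<and> h' \<cdot> k = k'" for h'
        by (rule assms(7)[of h' Q h]) (use that h in simp_all)
    qed (use h in simp)
  qed
  then show ?thesis
    unfolding is_pushout_def D(4-6) using D(1-3) assms(3-5) by (intro conjI ballI impI)
qed

end

text \<open>Axiom (C2) singles out some initial object; an arbitrary one is isomorphic to it, and
  \<open>f\<close> is that isomorphism followed by a cofibration. This is needed for the initial
  objects produced by reindexing.\<close>

lemma (in waldhausen_category) initial_cof:
  assumes z: "is_initial C z" and f: "f \<in> hom C z X"
  shows "f \<in> cof"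
proof -
  obtain z0 where z0: "is_initial C z0" "\<forall>A \<in> Ob C. \<forall>f \<in> hom C z0 A. f \<in> cof"
    using cof_initial by blast
  have ob: "z \<in> Ob C" "z0 \<in> Ob C" "X \<in> Ob C"
    using z z0 f cod_in_Ob by (auto simp: is_initial_def hom_def)
  obtain s t where s: "s \<in> hom C z z0" and t: "t \<in> hom C z0 z"
    using z z0(1) ob unfolding is_initial_def by blast
  have "t \<cdot> s = Id C z"
    using z ob comp_in_hom[OF s t] id_in_hom[OF ob(1)] unfolding is_initial_def by blast
  moreover have "s \<cdot> t = Id C z0"
    using z0(1) ob comp_in_hom[OF t s] id_in_hom[OF ob(2)] unfolding is_initial_def by blast
  ultimately have "s \<in> cof" using cof_iso is_isoI s t by blast
  moreover have ft: "f \<cdot> t \<in> cof" using comp_in_hom[OF t f] z0(2) ob by blast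
  ultimately have "(f \<cdot> t) \<cdot> s \<in> cof"
    by (rule cof_comp) (use s t f in \<open>auto simp: hom_def\<close>)
  also have "(f \<cdot> t) \<cdot> s = f"
    using s t f \<open>t \<cdot> s = Id C z\<close> by (auto simp: hom_def assoc)
  finally show ?thesis .
qed

section \<open>Cocartesian arrows\<close>

context grothendieck_opfibration
begin

abbreviation T_comp (infixr "\<bullet>" 70) where "g \<bullet> f \<equiv> Comp T g f"
abbreviation B_comp (infixr "\<star>" 70) where "g \<star> f \<equiv> Comp B g f"
abbreviation "pOb \<equiv> on_Ob p"
abbreviation "pMor \<equiv> on_Mor p"
abbreviation "fib \<equiv> fiber T B p"

text \<open>Recording the base arrow along with domain and codomain treats vertical and cocartesian
  arrows uniformly: for \<open>u = Id B A\<close> these are the hom sets of the fiber over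
  \<open>A\<close>.\<close>

definition over :: "'b \<Rightarrow> 'o \<Rightarrow> 'o \<Rightarrow> 'm set" where
  "over u X Y = {f \<in> hom T X Y. pMor f = u}"

definition cocart :: "'b \<Rightarrow> 'o \<Rightarrow> 'o \<Rightarrow> 'm set" where
  "cocart u X Y = {l \<in> over u X Y. is_cocartesian T B p l}"

lemma fiber_simps [simp]:
  "Comp (fib A) = Comp T" "Dom (fib A) = Dom T" "Cod (fib A) = Cod T" "Id (fib A) = Id T"
  "X \<in> Ob (fib A) \<longleftrightarrow> X \<in> Ob T \<and> pOb X = A"
  "f \<in> Mor (fib A) \<longleftrightarrow> f \<in> Mor T \<and> pMor f = Id B A"
  by (auto simp: fiber_def)

lemma hom_fiber [simp]: "hom (fib A) X Y = over (Id B A) X Y"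
  by (auto simp: hom_def over_def)

lemma p_simps [simp]:
  assumes "f \<in> Mor T"
  shows "pMor f \<in> Mor B" "Dom B (pMor f) = pOb (Dom T f)" "Cod B (pMor f) = pOb (Cod T f)"
  using map_hom[OF source.Mor_in_hom[OF assms]] by (auto simp: hom_def)

lemma p_comp [simp]:
  assumes "f \<in> Mor T" "g \<in> Mor T" "Dom T g = Cod T f"
  shows "pMor (g \<bullet> f) = pMor g \<star> pMor f"
  using map_comp[of f "Dom T f" "Cod T f" g "Cod T g"] assms by (auto simp: hom_def)

lemma overD:
  assumes "f \<in> over u X Y"
  shows "f \<in> Mor T" "Dom T f = X" "Cod T f = Y" "pMor f = u" "X \<in> Ob T" "Y \<in> Ob T"
    "u \<in> Mor B" "Dom B u = pOb X" "Cod B u = pOb Y" "pOb X \<in> Ob B" "pOb Y \<in> Ob B"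
  using assms source.dom_in_Ob source.cod_in_Ob map_Ob p_simps by (auto simp: over_def hom_def)

lemma overI: "f \<in> Mor T \<Longrightarrow> f \<in> over (pMor f) (Dom T f) (Cod T f)"
  by (simp add: over_def hom_def)

lemma over_comp: "f \<in> over u X Y \<Longrightarrow> g \<in> over v Y Z \<Longrightarrow> g \<bullet> f \<in> over (v \<star> u) X Z"
  by (auto simp: over_def hom_def)

lemma over_id: "X \<in> Ob T \<Longrightarrow> Id T X \<in> over (Id B (pOb X)) X X"
  by (auto simp: over_def hom_def map_id)

lemma over_comp_vertical:
  assumes "f \<in> over u X Y" "g \<in> over (Id B (pOb Y)) Y Z"
  shows "g \<bullet> f \<in> over u X Z"
  using over_comp[OF assms] overD[OF assms(1)] by auto

lemma over_comp_vertical':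
  assumes "f \<in> over (Id B (pOb X)) X Y" "g \<in> over u Y Z"
  shows "g \<bullet> f \<in> over u X Z"
  using over_comp[OF assms] overD[OF assms(1)] overD[OF assms(2)] by auto

lemma over_vertical: "f \<in> over (Id B A) X Y \<Longrightarrow> A \<in> Ob B \<Longrightarrow> pOb X = A \<and> pOb Y = A"
  using overD(8,9) target.id_simps by metis

lemma T_assoc:
  assumes "f \<in> over u X Y" "g \<in> over v Y Z" "h \<in> over w Z W"
  shows "(h \<bullet> g) \<bullet> f = h \<bullet> g \<bullet> f"
  by (rule source.assoc) (use overD[OF assms(1)] overD[OF assms(2)] overD[OF assms(3)] in auto)

lemma cocart_over: "l \<in> cocart u X Y \<Longrightarrow> l \<in> over u X Y"
  by (simp add: cocart_def)

lemma cocart_ex1: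
  assumes l: "l \<in> cocart u X Y" and g: "g \<in> over (v \<star> u) X Z"
    and v: "v \<in> Mor B" "Dom B v = pOb Y"
  shows "\<exists>!h. h \<in> over v Y Z \<and> h \<bullet> l = g"
proof -
  note lD = overD[OF cocart_over[OF l]] and gD = overD[OF g]
  have c: "is_cocartesian T B p l" using l by (simp add: cocart_def)
  have "\<exists>!h. h \<in> hom T (Cod T l) (Cod T g) \<and> pMor h = v \<and> h \<bullet> l = g"
  proof -
    have "v \<in> Mor B" "g \<in> Mor T" "Dom B v = Cod B (pMor l)" "Dom T g = Dom T l"
      "pMor g = v \<star> pMor l"
      using v lD gD by auto
    with c show ?thesis unfolding is_cocartesian_def by blast
  qed
  then show ?thesis using lD gD by (simp add: over_def conj_ac)
qed

lemma cocart_factor: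
  assumes "l \<in> cocart u X Y" "g \<in> over w X Z" "w = v \<star> u" "v \<in> Mor B" "Dom B v = pOb Y"
  obtains h where "h \<in> over v Y Z" "h \<bullet> l = g"
  using cocart_ex1[of l u X Y g v Z] assms by blast

lemma cocart_cancel:
  assumes l: "l \<in> cocart u X Y" and h: "h \<in> over v Y Z" and h': "h' \<in> over v Y Z"
    and eq: "h \<bullet> l = h' \<bullet> l"
  shows "h = h'"
proof -
  have "h \<bullet> l \<in> over (v \<star> u) X Z" using over_comp cocart_over l h by blast
  from cocart_ex1[OF l this] overD[OF h] h h' eq show ?thesis by auto
qed

lemma cocart_factor_vertical:
  assumes "l \<in> cocart u X Y" "g \<in> over u X Z"
  obtains h where "h \<in> over (Id B (pOb Y)) Y Z" "h \<bullet> l = g"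
proof -
  note lD = overD[OF cocart_over[OF assms(1)]]
  have "u = Id B (pOb Y) \<star> u" using lD by simp
  from cocart_factor[OF assms this] lD that show thesis by auto
qed

lemma cocartI:
  assumes l: "l \<in> over u X Y"
    and ex: "\<And>v g Z. v \<in> Mor B \<Longrightarrow> Dom B v = pOb Y \<Longrightarrow> g \<in> over (v \<star> u) X Z \<Longrightarrow>
               \<exists>h. h \<in> over v Y Z \<and> h \<bullet> l = g"
    and un: "\<And>v Z h h'. h \<in> over v Y Z \<Longrightarrow> h' \<in> over v Y Z \<Longrightarrow> h \<bullet> l = h' \<bullet> l \<Longrightarrow> h = h'"
  shows "l \<in> cocart u X Y"
proof -
  note lD = overD[OF l]
  have "\<exists>!h. h \<in> hom T (Cod T l) (Cod T g) \<and> pMor h = v \<and> h \<bullet> l = g"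
    if v: "v \<in> Mor B" "Dom B v = Cod B (pMor l)" and g: "g \<in> Mor T" "Dom T g = Dom T l"
      "pMor g = v \<star> pMor l" for v g
  proof -
    have "g \<in> over (v \<star> u) X (Cod T g)" using g lD by (simp add: over_def hom_def)
    then obtain h where h: "h \<in> over v Y (Cod T g)" "h \<bullet> l = g" using ex[of v g "Cod T g"] v lD by auto
    show ?thesis
    proof (rule ex1I)
      show "h \<in> hom T (Cod T l) (Cod T g) \<and> pMor h = v \<and> h \<bullet> l = g"
        using h lD by (simp add: over_def)
      show "h' = h" if "h' \<in> hom T (Cod T l) (Cod T g) \<and> pMor h' = v \<and> h' \<bullet> l = g" for h'
        using un[of h' v "Cod T g" h] that h lD by (simp add: over_def)
    qed
  qed
  then show ?thesis using l lD by (simp add: cocart_def is_cocartesian_def)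
qed

section \<open>Existence, composition and comparison of cocartesian arrows\<close>

lemma lift_cocart:
  assumes "u \<in> Mor B" "X \<in> Ob T" "Dom B u = pOb X"
  shows "lift u X \<in> cocart u X (push u X)"
  using assms lift_in_hom lift_above lift_cocartesian by (simp add: cocart_def over_def)

text \<open>A factorization problem is solved in two stages, through \<open>l\<close> over the
  composite base arrow and then through \<open>m\<close>. This replaces an explicit comparison of
  reindexing along a composite with the composite of the reindexing functors.\<close>

lemma cocart_comp:
  assumes l: "l \<in> cocart u X Y" and m: "m \<in> cocart v Y Z"
  shows "m \<bullet> l \<in> cocart (v \<star> u) X Z"
proof (rule cocartI)
  note lo = cocart_over[OF l] and mo = cocart_over[OF m]
  note lD = overD[OF lo] and mD = overD[OF mo]
  show "m \<bullet> l \<in> over (v \<star> u) X Z" by (rule over_comp[OF lo mo])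
  show "\<exists>h. h \<in> over w Z W \<and> h \<bullet> m \<bullet> l = g"
    if w: "w \<in> Mor B" "Dom B w = pOb Z" and g: "g \<in> over (w \<star> v \<star> u) X W" for w g W
  proof -
    have wv: "w \<star> v \<in> Mor B" "Dom B (w \<star> v) = pOb Y" "w \<star> v \<star> u = (w \<star> v) \<star> u"
      using w lD mD by (simp_all add: target.assoc)
    obtain h1 where h1: "h1 \<in> over (w \<star> v) Y W" "h1 \<bullet> l = g"
      using cocart_factor[OF l g wv(3,1,2)] .
    obtain h where h: "h \<in> over w Z W" "h \<bullet> m = h1"
      using cocart_factor[OF m h1(1) refl w] .
    have "h \<bullet> m \<bullet> l = g" using T_assoc[OF lo mo h(1)] h h1 by simp
    with h show ?thesis by blast
  qed
  show "h = h'" if h: "h \<in> over w Z W" "h' \<in> over w Z W" "h \<bullet> m \<bullet> l = h' \<bullet> m \<bullet> l" for w W h h'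
  proof -
    have "(h \<bullet> m) \<bullet> l = (h' \<bullet> m) \<bullet> l" using h T_assoc[OF lo mo] by simp
    from cocart_cancel[OF l over_comp[OF mo h(1)] over_comp[OF mo h(2)] this]
    show ?thesis using cocart_cancel[OF m h(1,2)] by blast
  qed
qed

text \<open>Precomposition with the inverse of \<open>f\<close> both produces and determines the
  required factor; it lies over the right arrow because \<open>p\<close> sends the inverse to a
  right inverse of \<open>u\<close>.\<close>

lemma iso_cocart:
  assumes f: "f \<in> over u X Y" and iso: "is_iso T f"
  shows "f \<in> cocart u X Y"
proof -
  note fD = overD[OF f]
  obtain g where "g \<in> hom T Y X" and gf: "g \<bullet> f = Id T X" "f \<bullet> g = Id T Y"
    using source.is_isoE[OF iso] fD by (auto simp: hom_def)
  then have g: "g \<in> over (pMor g) Y X" by (simp add: over_def)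
  note gD = overD[OF g]
  have pgf: "u \<star> pMor g = Id B (pOb Y)"
    using p_comp[of g f] fD gD gf map_id by simp
  show ?thesis
  proof (rule cocartI[OF f])
    show "\<exists>h'. h' \<in> over v Y Z \<and> h' \<bullet> f = h"
      if v: "v \<in> Mor B" "Dom B v = pOb Y" and h: "h \<in> over (v \<star> u) X Z" for v h Z
    proof (intro exI conjI)
      have "(v \<star> u) \<star> pMor g = v"
        using v pgf fD gD by (simp add: target.assoc)
      then show "h \<bullet> g \<in> over v Y Z" using over_comp[OF g h] by simp
      show "(h \<bullet> g) \<bullet> f = h" using T_assoc[OF f g h] gf overD[OF h] by simp
    qed
    show "h = h'" if h: "h \<in> over v Y Z" "h' \<in> over v Y Z" "h \<bullet> f = h' \<bullet> f" for v Z h h'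
    proof -
      have "h = (h \<bullet> f) \<bullet> g" using T_assoc[OF g f h(1)] gf overD[OF h(1)] by simp
      also have "\<dots> = h'" using T_assoc[OF g f h(2)] gf overD[OF h(2)] h(3) by simp
      finally show ?thesis .
    qed
  qed
qed

lemma id_is_iso: "X \<in> Ob T \<Longrightarrow> is_iso (fib (pOb X)) (Id T X)"
  using over_id[of X] overD[OF over_id[of X]] unfolding is_iso_def by (auto intro!: bexI[of _ "Id T X"])

lemma cocart_id:
  assumes "X \<in> Ob T"
  shows "Id T X \<in> cocart (Id B (pOb X)) X X"
proof (rule iso_cocart[OF over_id[OF assms]])
  show "is_iso T (Id T X)"
    using assms by (intro source.is_isoI[of _ X X "Id T X"]) (auto simp: source.id_in_hom)
qed

text \<open>Each arrow factors vertically through the other, and cancellation makes the two factors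
  mutually inverse. This is the source of all independence from the chosen cleavage.\<close>

lemma cocart_comparison:
  assumes l: "l \<in> cocart u X Y" and l': "l' \<in> cocart u X Y'"
  obtains s where "s \<in> over (Id B (pOb Y)) Y Y'" "s \<bullet> l = l'" "is_iso (fib (pOb Y)) s"
proof -
  note lo = cocart_over[OF l] and lo' = cocart_over[OF l']
  note lD = overD[OF lo] and lD' = overD[OF lo']
  have pY: "pOb Y' = pOb Y" using lD lD' by simp
  obtain s where s: "s \<in> over (Id B (pOb Y)) Y Y'" "s \<bullet> l = l'"
    using cocart_factor_vertical[OF l lo'] .
  obtain t where t: "t \<in> over (Id B (pOb Y)) Y' Y" "t \<bullet> l' = l"
    using cocart_factor_vertical[OF l' lo] pY by auto
  have "t \<bullet> s = Id T Y"
  proof (rule cocart_cancel[OF l])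
    show "t \<bullet> s \<in> over (Id B (pOb Y)) Y Y" using over_comp_vertical s t pY by metis
    show "(t \<bullet> s) \<bullet> l = Id T Y \<bullet> l" using T_assoc[OF lo s(1) t(1)] s t lD by simp
  qed (use over_id lD in simp)
  moreover have "s \<bullet> t = Id T Y'"
  proof (rule cocart_cancel[OF l'])
    show "s \<bullet> t \<in> over (Id B (pOb Y)) Y' Y'" using over_comp_vertical s t pY by metis
    show "(s \<bullet> t) \<bullet> l' = Id T Y' \<bullet> l'" using T_assoc[OF lo' t(1) s(1)] s t lD' by simp
  qed (use over_id[of Y'] lD' pY in simp)
  ultimately have "is_iso (fib (pOb Y)) s"
    using s t overD[OF s(1)] overD[OF t(1)] unfolding is_iso_def by auto
  with s that show thesis by blast
qed

section \<open>Vertical factors for the chosen lifts, and the reindexing functors\<close>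

lemma induced_props:
  assumes "f \<in> over u X Y"
  shows "induced T B p push lift f \<in> over (Id B (pOb Y)) (push u X) Y"
    and "induced T B p push lift f \<bullet> lift u X = f"
proof -
  note fD = overD[OF assms]
  from theI'[OF ex1_induced[of f]] fD
  show "induced T B p push lift f \<in> over (Id B (pOb Y)) (push u X) Y"
    and "induced T B p push lift f \<bullet> lift u X = f"
    unfolding induced_def Let_def by auto
qed

abbreviation "reidx \<equiv> reindex T B p push lift"

text \<open>Turns the action of reindexing on morphisms into the naturality square of the chosen
  lifts, the form suited to diagram chases.\<close>

lemma reindex_props:
  assumes k: "k \<in> over (Id B (pOb X)) X Y" and u: "u \<in> Mor B" "Dom B u = pOb X"
  shows "on_Mor (reidx u) k \<in> over (Id B (Cod B u)) (push u X) (push u Y)"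
    and "on_Mor (reidx u) k \<bullet> lift u X = lift u Y \<bullet> k"
proof -
  note kD = overD[OF k]
  have pY: "pOb Y = pOb X" using kD by simp
  have l: "lift u Y \<in> over u Y (push u Y)" using lift_cocart cocart_over u kD pY by simp
  have "lift u Y \<bullet> k \<in> over u X (push u Y)" using over_comp_vertical'[OF k l] .
  from induced_props[OF this] overD[OF l] kD
  show "on_Mor (reidx u) k \<in> over (Id B (Cod B u)) (push u X) (push u Y)"
    and "on_Mor (reidx u) k \<bullet> lift u X = lift u Y \<bullet> k"
    by (auto simp: reindex_def)
qed

end

section \<open>Classes of fiber morphisms stable under reindexing\<close>

text \<open>The closure arguments are the same for cofibrations and weak equivalences and rest on
  these shared properties, so they are carried out once and instantiated for both classes.\<close>

locale stable_class = grothendieck_opfibration T B p push lift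
  for T :: "('o, 'm) cat" and B :: "('a, 'b) cat" and p :: "('o, 'm, 'a, 'b) functor_data"
    and push :: "'b \<Rightarrow> 'o \<Rightarrow> 'o" and lift :: "'b \<Rightarrow> 'o \<Rightarrow> 'm" +
  fixes cls :: "'a \<Rightarrow> 'm set"
  assumes cls_subset: "A \<in> Ob B \<Longrightarrow> cls A \<subseteq> Mor (fib A)"
    and cls_iso: "A \<in> Ob B \<Longrightarrow> is_iso (fib A) f \<Longrightarrow> f \<in> cls A"
    and cls_comp: "A \<in> Ob B \<Longrightarrow> f \<in> cls A \<Longrightarrow> g \<in> cls A \<Longrightarrow> Dom T g = Cod T f \<Longrightarrow> g \<bullet> f \<in> cls A"
    and cls_reindex: "u \<in> Mor B \<Longrightarrow> k \<in> cls (Dom B u) \<Longrightarrow> on_Mor (reidx u) k \<in> cls (Cod B u)"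
begin

text \<open>Only the fiber half of membership in a total class; the base half is handled separately
  through functoriality of \<open>p\<close>.\<close>

definition vert :: "'m \<Rightarrow> bool" where
  "vert g \<longleftrightarrow> g \<in> Mor T \<and> induced T B p push lift g \<in> cls (Cod B (pMor g))"

text \<open>The comparison isomorphism \<open>s\<close> between the two cocartesian arrows gives
  \<open>g' = g \<bullet> s\<close>, and the class contains isomorphisms and is closed under
  composition.\<close>

lemma cls_factor_transfer:
  assumes l: "l \<in> cocart u X M" and l': "l' \<in> cocart u X M'"
    and g: "g \<in> over (Id B (pOb Y)) M Y" and g': "g' \<in> over (Id B (pOb Y)) M' Y"
    and eq: "g \<bullet> l = g' \<bullet> l'" and c: "g \<in> cls (pOb Y)"
  shows "g' \<in> cls (pOb Y)"
proof -
  obtain s where s: "s \<in> over (Id B (pOb M')) M' M" "s \<bullet> l' = l" "is_iso (fib (pOb M')) s"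
    using cocart_comparison[OF l' l] .
  note gD = overD[OF g] and gD' = overD[OF g'] and sD = overD[OF s(1)]
  have pM: "pOb M' = pOb Y" using gD' by simp
  have s1: "s \<in> over (Id B (pOb Y)) M' M" using s pM by simp
  have "g \<bullet> s \<in> over (Id B (pOb Y)) M' Y" using over_comp[OF s1 g] gD by simp
  moreover have "g' \<bullet> l' = (g \<bullet> s) \<bullet> l'"
    using T_assoc[OF cocart_over[OF l'] s1 g] s eq by simp
  ultimately have "g' = g \<bullet> s" using cocart_cancel[OF l' g'] by blast
  moreover have "g \<bullet> s \<in> cls (pOb Y)"
    using cls_comp[of "pOb Y" s g] cls_iso[of "pOb Y" s] s pM gD sD c by simp
  ultimately show ?thesis by simp
qed

text \<open>Transfer in both directions between \<open>l\<close> and the chosen lift frees the test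
  from the cleavage.\<close>

lemma vert_iff:
  assumes l: "l \<in> cocart u X M" and g: "g \<in> over (Id B (pOb Y)) M Y" and f: "g \<bullet> l = f"
  shows "vert f \<longleftrightarrow> g \<in> cls (pOb Y)"
proof -
  have fo: "f \<in> over u X Y" using over_comp[OF cocart_over[OF l] g] f overD[OF g] overD[OF cocart_over[OF l]] by simp
  note fD = overD[OF fo]
  have l': "lift u X \<in> cocart u X (push u X)" using lift_cocart fD by simp
  from cls_factor_transfer[OF l l' g induced_props(1)[OF fo]] f
    cls_factor_transfer[OF l' l induced_props(1)[OF fo] g] induced_props(2)[OF fo] fD
  show ?thesis unfolding vert_def by auto
qed

lemma vert_factor:
  assumes f: "f \<in> over u X Y" and v: "vert f"
  obtains l M g where "l \<in> cocart u X M" "g \<in> over (Id B (pOb Y)) M Y" "g \<bullet> l = f" "g \<in> cls (pOb Y)"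
  using that[of "lift u X" "push u X"] lift_cocart[of u X] induced_props[OF f] v overD[OF f]
  unfolding vert_def by auto

text \<open>For a vertical morphism the identity serves as the cocartesian factor.\<close>

lemma vert_fiber_iff:
  assumes g: "g \<in> over (Id B A) X Y" and A: "A \<in> Ob B"
  shows "vert g \<longleftrightarrow> g \<in> cls A"
proof -
  have pX: "pOb X = A" "pOb Y = A" using over_vertical[OF g A] by auto
  show ?thesis using vert_iff[OF cocart_id, of X g Y g] overD[OF g] g pX by simp
qed

lemma vert_cocart:
  assumes l: "l \<in> cocart u X Y"
  shows "vert l"
  using vert_iff[OF l over_id] cls_iso[OF _ id_is_iso, of Y] overD[OF cocart_over[OF l]] by auto

lemma vert_iso: "is_iso T f \<Longrightarrow> vert f"
  using vert_cocart[OF iso_cocart[OF overI]] by (auto simp: is_iso_def)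

section \<open>Base change and composition of fiber parts\<close>

text \<open>The reindexed \<open>k\<close>, followed by the comparison from the chosen lift at
  \<open>Y\<close> to \<open>m\<close>, is a vertical factor of \<open>m \<bullet> k\<close> through
  the chosen lift at \<open>X\<close>. Transfer to \<open>l\<close> then yields
  \<open>k'\<close>.\<close>

lemma cls_base_change:
  assumes k: "k \<in> over (Id B (pOb X)) X Y" "k \<in> cls (pOb X)"
    and l: "l \<in> cocart u X X'" and m: "m \<in> cocart u Y Y'"
    and k': "k' \<in> over (Id B (pOb Y')) X' Y'" "k' \<bullet> l = m \<bullet> k"
  shows "k' \<in> cls (pOb Y')"
proof -
  note lD = overD[OF cocart_over[OF l]] and mD = overD[OF cocart_over[OF m]]
  note lX = lift_cocart[of u X] and lY = lift_cocart[of u Y]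
  let ?r = "on_Mor (reidx u) k"
  have r: "?r \<in> over (Id B (pOb Y')) (push u X) (push u Y)" "?r \<bullet> lift u X = lift u Y \<bullet> k"
    using reindex_props[OF k(1), of u] lD mD by auto
  have rc: "?r \<in> cls (pOb Y')" using cls_reindex[of u k] k lD mD by simp
  note rD = overD[OF r(1)]
  obtain s where s: "s \<in> over (Id B (pOb Y')) (push u Y) Y'" "s \<bullet> lift u Y = m" "is_iso (fib (pOb Y')) s"
    using cocart_comparison[OF lY m] mD lD rD by auto
  note sD = overD[OF s(1)]
  have "s \<bullet> ?r \<in> cls (pOb Y')"
    using cls_comp[of "pOb Y'" ?r s] cls_iso[OF _ s(3)] rc rD sD by simp
  moreover have sr: "s \<bullet> ?r \<in> over (Id B (pOb Y')) (push u X) Y'"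
    using over_comp[OF r(1) s(1)] sD by simp
  moreover have "(s \<bullet> ?r) \<bullet> lift u X = k' \<bullet> l"
    using T_assoc[OF cocart_over[OF lX] r(1) s(1)] T_assoc[OF k(1) cocart_over[OF lY] s(1)] r s k' lD mD
    by simp
  ultimately show ?thesis
    using cls_factor_transfer[OF lX l sr k'(1)] lD by simp
qed

text \<open>With \<open>f = f1 \<bullet> l\<close> and \<open>g = g1 \<bullet> m\<close>, the
  vertical \<open>f1\<close> is moved past \<open>m\<close>: its base change \<open>f2\<close> along
  \<open>v\<close> splits the composite into the cocartesian \<open>lift v M \<bullet> l\<close> and
  the vertical \<open>g1 \<bullet> f2\<close>.\<close>

lemma vert_comp:
  assumes f: "f \<in> over u X Y" "vert f" and g: "g \<in> over v Y Z" "vert g"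
  shows "vert (g \<bullet> f)"
proof -
  obtain l M f1 where l: "l \<in> cocart u X M" and f1: "f1 \<in> over (Id B (pOb Y)) M Y"
      "f1 \<bullet> l = f" "f1 \<in> cls (pOb Y)"
    using vert_factor[OF f] .
  obtain m N g1 where m: "m \<in> cocart v Y N" and g1: "g1 \<in> over (Id B (pOb Z)) N Z"
      "g1 \<bullet> m = g" "g1 \<in> cls (pOb Z)"
    using vert_factor[OF g] .
  note fD = overD[OF f1(1)] and gD = overD[OF g1(1)] and mo = cocart_over[OF m] and lo = cocart_over[OF l]
  note mD = overD[OF mo]
  have pM: "pOb M = pOb Y" and pN: "pOb N = pOb Z" using fD gD by auto
  have n: "lift v M \<in> cocart v M (push v M)" using lift_cocart fD mD by simp
  note no = cocart_over[OF n]
  have mf: "m \<bullet> f1 \<in> over v M N" using over_comp_vertical'[OF _ mo, of f1] f1 pM by simp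
  obtain f2 where f2: "f2 \<in> over (Id B (pOb Z)) (push v M) N" "f2 \<bullet> lift v M = m \<bullet> f1"
    using cocart_factor_vertical[OF n mf] overD[OF no] mD pN by auto
  have "f2 \<in> cls (pOb Z)"
    using cls_base_change[OF _ _ n m, of f1 f2] f1 f2 pM pN by simp
  then have "g1 \<bullet> f2 \<in> cls (pOb Z)"
    using cls_comp[of "pOb Z" f2 g1] g1 overD[OF f2(1)] gD by simp
  moreover have g1f2: "g1 \<bullet> f2 \<in> over (Id B (pOb Z)) (push v M) Z"
    using over_comp[OF f2(1) g1(1)] gD by simp
  moreover have "(g1 \<bullet> f2) \<bullet> lift v M \<bullet> l = g \<bullet> f"
  proof -
    have "(g1 \<bullet> f2) \<bullet> lift v M \<bullet> l = g1 \<bullet> (f2 \<bullet> lift v M) \<bullet> l"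
      using T_assoc[OF over_comp[OF lo no] f2(1) g1(1)] T_assoc[OF lo no f2(1)] by simp
    also have "\<dots> = g1 \<bullet> m \<bullet> f" using f2 f1 T_assoc[OF lo f1(1) mo] by simp
    also have "\<dots> = g \<bullet> f" using T_assoc[OF f(1) mo g1(1)] g1 by simp
    finally show ?thesis .
  qed
  ultimately show ?thesis using vert_iff[OF cocart_comp[OF l n]] by blast
qed

text \<open>Both paths of the square are split into a cocartesian arrow out of \<open>Y\<close> and
  a vertical arrow into \<open>Y1'\<close>. Comparing the splittings carries the property from the
  fiber part of \<open>g\<close>, moved along \<open>x'\<close>, to the fiber part of
  \<open>g1\<close>.\<close>

lemma vert_base_change:
  assumes g: "g \<in> over u Y Y'" "vert g"
    and l: "l \<in> cocart x Y Y1" and l': "l' \<in> cocart x' Y' Y1'"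
    and g1: "g1 \<in> over w Y1 Y1'" "g1 \<bullet> l = l' \<bullet> g"
  shows "vert g1"
proof -
  note lo = cocart_over[OF l] and lo' = cocart_over[OF l']
  note lD = overD[OF lo] and lD' = overD[OF lo'] and gD = overD[OF g1(1)] and gD0 = overD[OF g(1)]
  have wx: "w \<star> x = x' \<star> u"
    using arg_cong[OF g1(2), of pMor] lD lD' gD gD0 by simp
  obtain n N h where n: "n \<in> cocart u Y N" and h: "h \<in> over (Id B (pOb Y')) N Y'"
      "h \<bullet> n = g" "h \<in> cls (pOb Y')"
    using vert_factor[OF g] .
  note no = cocart_over[OF n] and hD = overD[OF h(1)]
  have pN: "pOb N = pOb Y'" using hD by simp
  have q: "lift x' N \<in> cocart x' N (push x' N)" using lift_cocart hD lD' by simp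
  note qo = cocart_over[OF q]
  have lh: "l' \<bullet> h \<in> over x' N Y1'" using over_comp_vertical'[OF _ lo', of h] h pN by simp
  obtain h1 where h1: "h1 \<in> over (Id B (pOb Y1')) (push x' N) Y1'" "h1 \<bullet> lift x' N = l' \<bullet> h"
    using cocart_factor_vertical[OF q lh] overD[OF qo] lD' by auto
  have h1c: "h1 \<in> cls (pOb Y1')"
    using cls_base_change[OF _ _ q l', of h h1] h h1 pN by simp
  have m: "lift w Y1 \<in> cocart w Y1 (push w Y1)" using lift_cocart lD gD by simp
  note mo = cocart_over[OF m]
  obtain g2 where g2: "g2 \<in> over (Id B (pOb Y1')) (push w Y1) Y1'" "g2 \<bullet> lift w Y1 = g1"
    using cocart_factor_vertical[OF m g1(1)] overD[OF mo] gD by auto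
  \<comment> \<open>The base equation \<open>wx\<close> places this composite over the same arrow as
    \<open>lift x' N \<bullet> n\<close>, so the two can be compared.\<close>
  have ml: "lift w Y1 \<bullet> l \<in> cocart (x' \<star> u) Y (push w Y1)" using cocart_comp[OF l m] wx by simp
  have "g2 \<bullet> lift w Y1 \<bullet> l = l' \<bullet> g" using T_assoc[OF lo mo g2(1)] g2 g1 by simp
  also have "\<dots> = h1 \<bullet> lift x' N \<bullet> n"
    using T_assoc[OF no qo h1(1)] T_assoc[OF no h(1) lo'] h1 h by simp
  finally have "g2 \<in> cls (pOb Y1')"
    using cls_factor_transfer[OF cocart_comp[OF n q] ml h1(1) g2(1)] h1c by simp
  then show ?thesis using vert_iff[OF m g2] by blast
qed

text \<open>Treats one corner of the gluing diagram: \<open>a\<close> is extended over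
  \<open>w\<close> along the cocartesian arrows, and the extension is split at the chosen lift. Its
  fiber part \<open>a2\<close> stays in the class by base change.\<close>

lemma vert_extend:
  assumes a: "a \<in> over u X X'" "vert a"
    and l: "l \<in> cocart x X X1" and l': "l' \<in> cocart x' X' X1'"
    and w: "w \<in> Mor B" "Dom B w = pOb X1" "w \<star> x = x' \<star> u"
  obtains a1 a2 where "a1 \<in> over w X1 X1'" "a1 \<bullet> l = l' \<bullet> a"
    "a2 \<in> over (Id B (pOb X1')) (push w X1) X1'" "a2 \<bullet> lift w X1 = a1" "a2 \<in> cls (pOb X1')"
proof -
  have "l' \<bullet> a \<in> over (x' \<star> u) X X1'" using over_comp[OF a(1) cocart_over[OF l']] .
  then obtain a1 where a1: "a1 \<in> over w X1 X1'" "a1 \<bullet> l = l' \<bullet> a"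
    using cocart_factor[OF l _ w(3)[symmetric] w(1,2)] by blast
  have m: "lift w X1 \<in> cocart w X1 (push w X1)"
    using lift_cocart[OF w(1) _ w(2)] overD[OF cocart_over[OF l]] by blast
  have "pOb (push w X1) = pOb X1'" using overD(9)[OF cocart_over[OF m]] overD(9)[OF a1(1)] by simp
  then obtain a2 where a2: "a2 \<in> over (Id B (pOb X1')) (push w X1) X1'" "a2 \<bullet> lift w X1 = a1"
    using cocart_factor_vertical[OF m a1(1)] by auto
  have "vert a1" by (rule vert_base_change[OF a l l' a1])
  then have "a2 \<in> cls (pOb X1')" using vert_iff[OF m a2] by blast
  with that a1 a2 show thesis by blast
qed

end

section \<open>The total category\<close>

text \<open>Exactness of the reindexing functors supplies the stability requirement.\<close>

sublocale waldhausen_opfibration \<subseteq> cof: stable_class T B p push lift cof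
proof
  fix A f assume A: "A \<in> Ob B"
  interpret F: waldhausen_category "fib A" "cof A" "weq A" using fiber_waldhausen[OF A] .
  show "cof A \<subseteq> Mor (fib A)" by (rule F.cof_subset)
  show "is_iso (fib A) f \<Longrightarrow> f \<in> cof A" by (rule F.cof_iso)
  show "g \<bullet> f \<in> cof A" if "f \<in> cof A" "g \<in> cof A" "Dom T g = Cod T f" for g
    using F.cof_comp[of f g] that by simp
next
  show "on_Mor (reidx u) k \<in> cof (Cod B u)" if "u \<in> Mor B" "k \<in> cof (Dom B u)" for u k
    using exact_functor.preserves_cof[OF reindex_exact[OF that(1)] that(2)] .
qed

sublocale waldhausen_opfibration \<subseteq> weq: stable_class T B p push lift weq
proof
  fix A f assume A: "A \<in> Ob B"
  interpret F: waldhausen_category "fib A" "cof A" "weq A" using fiber_waldhausen[OF A] .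
  show "weq A \<subseteq> Mor (fib A)" by (rule F.weq_subset)
  show "is_iso (fib A) f \<Longrightarrow> f \<in> weq A" by (rule F.weq_iso)
  show "g \<bullet> f \<in> weq A" if "f \<in> weq A" "g \<in> weq A" "Dom T g = Cod T f" for g
    using F.weq_comp[of f g] that by simp
next
  show "on_Mor (reidx u) k \<in> weq (Cod B u)" if "u \<in> Mor B" "k \<in> weq (Dom B u)" for u k
    using exact_functor.preserves_weq[OF reindex_exact[OF that(1)] that(2)] .
qed

context waldhausen_opfibration
begin

section \<open>Pushouts in the fibers and in the total category\<close>

lemma fiber_pushoutD:
  assumes "is_pushout (fib A) i f j k"
  shows "i \<in> over (Id B A) (Dom T i) (Cod T i)" "f \<in> over (Id B A) (Dom T i) (Cod T f)"
    "j \<in> over (Id B A) (Cod T i) (Cod T j)" "k \<in> over (Id B A) (Cod T f) (Cod T j)"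
    "j \<bullet> i = k \<bullet> f"
proof -
  have "i \<in> Mor (fib A)" "f \<in> Mor (fib A)" "Dom (fib A) i = Dom (fib A) f"
    "j \<in> hom (fib A) (Cod (fib A) i) (Cod (fib A) j)" "k \<in> hom (fib A) (Cod (fib A) f) (Cod (fib A) j)"
    "Comp (fib A) j i = Comp (fib A) k f"
    using assms unfolding is_pushout_def by blast+
  then show "i \<in> over (Id B A) (Dom T i) (Cod T i)" "f \<in> over (Id B A) (Dom T i) (Cod T f)"
    "j \<in> over (Id B A) (Cod T i) (Cod T j)" "k \<in> over (Id B A) (Cod T f) (Cod T j)"
    "j \<bullet> i = k \<bullet> f"
    using overI[of i] overI[of f] by simp_all
qed

text \<open>A cocone under the span in \<open>T\<close> lies over a single arrow \<open>w\<close>, because the legs of the span are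
  vertical; it therefore amounts to a cocone under the span reindexed along \<open>w\<close>.\<close>

lemma fiber_pushout_is_pushout:
  assumes A: "A \<in> Ob B" and i: "i \<in> cof A" and po: "is_pushout (fib A) i f j k"
  shows "is_pushout T i f j k"
proof -
  define X Y Z P where "X = Dom T i" "Y = Cod T i" "Z = Cod T f" "P = Cod T j"
  note S = fiber_pushoutD[OF po, folded X_Y_Z_P_def]
  note iD = overD[OF S(1)] and fD = overD[OF S(2)] and jD = overD[OF S(3)] and kD = overD[OF S(4)]
  have pA: "pOb X = A" "pOb Y = A" "pOb Z = A" "pOb P = A"
    using over_vertical[OF _ A] S by blast+
  show ?thesis
  proof (rule source.is_pushoutI[of i X Y f Z j P k])
    fix Q j' k'
    assume j': "j' \<in> hom T Y Q" and k': "k' \<in> hom T Z Q" and eq: "j' \<bullet> i = k' \<bullet> f"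
    define w where "w = pMor j'"
    have j'o: "j' \<in> over w Y Q" using j' by (simp add: over_def w_def)
    note j'D = overD[OF j'o]
    have "pMor k' = w"
      using arg_cong[OF eq, of pMor] k' iD fD j'D pA by (simp add: hom_def)
    then have k'o: "k' \<in> over w Z Q" using k' by (simp add: over_def)
    have w: "w \<in> Mor B" "Dom B w = A" "Cod B w = pOb Q" "pOb Q \<in> Ob B" using j'D pA by auto
    interpret F: category "fib (pOb Q)"
      using fiber_waldhausen[OF w(4)] by (simp add: waldhausen_category_def)
    let ?r = "on_Mor (reidx w)"
    \<comment> \<open>Here \<open>i\<close> being a cofibration matters: exactness provides
      preservation of pushouts along cofibrations.\<close>
    have po': "is_pushout (fib (pOb Q)) (?r i) (?r f) (?r j) (?r k)"
      using exact_functor.preserves_pushout[OF reindex_exact[OF w(1)]] i po w by simp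
    note l = lift_cocart[OF w(1)]
    have lX: "lift w X \<in> cocart w X (push w X)" and lY: "lift w Y \<in> cocart w Y (push w Y)"
      and lZ: "lift w Z \<in> cocart w Z (push w Z)" and lP: "lift w P \<in> cocart w P (push w P)"
      using l w pA iD fD jD by simp_all
    note lo = lX[THEN cocart_over] lY[THEN cocart_over] lZ[THEN cocart_over] lP[THEN cocart_over]
    have R: "?r i \<in> over (Id B (pOb Q)) (push w X) (push w Y)" "?r i \<bullet> lift w X = lift w Y \<bullet> i"
      "?r f \<in> over (Id B (pOb Q)) (push w X) (push w Z)" "?r f \<bullet> lift w X = lift w Z \<bullet> f"
      "?r j \<in> over (Id B (pOb Q)) (push w Y) (push w P)" "?r j \<bullet> lift w Y = lift w P \<bullet> j"
      "?r k \<in> over (Id B (pOb Q)) (push w Z) (push w P)" "?r k \<bullet> lift w Z = lift w P \<bullet> k"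
      using reindex_props[of i X Y w] reindex_props[of f X Z w] reindex_props[of j Y P w]
        reindex_props[of k Z P w] S w pA by auto
    note RD = overD[OF R(1)] overD[OF R(3)] overD[OF R(5)] overD[OF R(7)]
    have pp: "pOb (push w Y) = pOb Q" "pOb (push w Z) = pOb Q" using overD[OF lo(2)] overD[OF lo(3)] w by auto
    obtain j1 where j1: "j1 \<in> over (Id B (pOb Q)) (push w Y) Q" "j1 \<bullet> lift w Y = j'"
      using cocart_factor_vertical[OF lY j'o] pp by auto
    obtain k1 where k1: "k1 \<in> over (Id B (pOb Q)) (push w Z) Q" "k1 \<bullet> lift w Z = k'"
      using cocart_factor_vertical[OF lZ k'o] pp by auto
    \<comment> \<open>Arrows out of \<open>push w X\<close> over a common base arrow may be compared
      after the cocartesian \<open>lift w X\<close>, where the claim becomes the given cocone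
      equation.\<close>
    have "j1 \<bullet> ?r i = k1 \<bullet> ?r f"
    proof (rule cocart_cancel[OF lX])
      show "j1 \<bullet> ?r i \<in> over (Id B (pOb Q)) (push w X) Q" "k1 \<bullet> ?r f \<in> over (Id B (pOb Q)) (push w X) Q"
        using over_comp[OF R(1) j1(1)] over_comp[OF R(3) k1(1)] w by auto
      show "(j1 \<bullet> ?r i) \<bullet> lift w X = (k1 \<bullet> ?r f) \<bullet> lift w X"
        using T_assoc[OF lo(1) R(1) j1(1)] T_assoc[OF lo(1) R(3) k1(1)]
          T_assoc[OF S(1) lo(2) j1(1)] T_assoc[OF S(2) lo(3) k1(1)] R j1 k1 eq by simp
    qed
    then obtain h1 where h1: "h1 \<in> over (Id B (pOb Q)) (push w P) Q" "h1 \<bullet> ?r j = j1" "h1 \<bullet> ?r k = k1"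
      using F.pushout_universal[OF po', of j1 Q k1] j1 k1 RD by auto
    have "h1 \<bullet> lift w P \<in> hom T P Q" using overD[OF h1(1)] overD[OF lo(4)] by (simp add: hom_def)
    moreover have "(h1 \<bullet> lift w P) \<bullet> j = j'"
      using T_assoc[OF S(3) lo(4) h1(1)] T_assoc[OF lo(2) R(5) h1(1)] R h1 j1 by simp
    moreover have "(h1 \<bullet> lift w P) \<bullet> k = k'"
      using T_assoc[OF S(4) lo(4) h1(1)] T_assoc[OF lo(3) R(7) h1(1)] R h1 k1 by simp
    ultimately show "\<exists>h. h \<in> hom T P Q \<and> h \<bullet> j = j' \<and> h \<bullet> k = k'" by blast
  next
    fix Q h h'
    assume h: "h \<in> hom T P Q" "h' \<in> hom T P Q" and eq: "h \<bullet> j = h' \<bullet> j" "h \<bullet> k = h' \<bullet> k"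
    define w where "w = pMor h"
    have ho: "h \<in> over w P Q" using h by (simp add: over_def w_def)
    note hD = overD[OF ho]
    \<comment> \<open>Since \<open>j\<close> is vertical, agreement on this leg alone forces equal
      base arrows.\<close>
    have "pMor h' = w"
      using arg_cong[OF eq(1), of pMor] h hD jD pA by (simp add: hom_def)
    then have h'o: "h' \<in> over w P Q" using h by (simp add: over_def)
    have w: "w \<in> Mor B" "Dom B w = A" "Cod B w = pOb Q" "pOb Q \<in> Ob B" using hD pA by auto
    interpret F: category "fib (pOb Q)"
      using fiber_waldhausen[OF w(4)] by (simp add: waldhausen_category_def)
    let ?r = "on_Mor (reidx w)"
    have po': "is_pushout (fib (pOb Q)) (?r i) (?r f) (?r j) (?r k)"
      using exact_functor.preserves_pushout[OF reindex_exact[OF w(1)]] i po w by simp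
    note l = lift_cocart[OF w(1)]
    have lY: "lift w Y \<in> cocart w Y (push w Y)"
      and lZ: "lift w Z \<in> cocart w Z (push w Z)" and lP: "lift w P \<in> cocart w P (push w P)"
      using l w pA iD fD jD by simp_all
    note lo = lY[THEN cocart_over] lZ[THEN cocart_over] lP[THEN cocart_over]
    have R: "?r j \<in> over (Id B (pOb Q)) (push w Y) (push w P)" "?r j \<bullet> lift w Y = lift w P \<bullet> j"
      "?r k \<in> over (Id B (pOb Q)) (push w Z) (push w P)" "?r k \<bullet> lift w Z = lift w P \<bullet> k"
      using reindex_props[of j Y P w] reindex_props[of k Z P w] S w pA by auto
    have pp: "pOb (push w P) = pOb Q" using overD[OF lo(3)] w by auto
    obtain g where g: "g \<in> over (Id B (pOb Q)) (push w P) Q" "g \<bullet> lift w P = h"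
      using cocart_factor_vertical[OF lP ho] pp by auto
    obtain g' where g': "g' \<in> over (Id B (pOb Q)) (push w P) Q" "g' \<bullet> lift w P = h'"
      using cocart_factor_vertical[OF lP h'o] pp by auto
    \<comment> \<open>The fiber parts agree on both reindexed legs, each equality being tested after
      a cocartesian lift.\<close>
    have "g = g'"
    proof (rule F.pushout_unique_arrow[OF po'])
      have "g \<bullet> ?r j = g' \<bullet> ?r j"
      proof (rule cocart_cancel[OF lY])
        show "g \<bullet> ?r j \<in> over (Id B (pOb Q)) (push w Y) Q" "g' \<bullet> ?r j \<in> over (Id B (pOb Q)) (push w Y) Q"
          using over_comp[OF R(1) g(1)] over_comp[OF R(1) g'(1)] w by auto
        show "(g \<bullet> ?r j) \<bullet> lift w Y = (g' \<bullet> ?r j) \<bullet> lift w Y"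
          using T_assoc[OF lo(1) R(1) g(1)] T_assoc[OF lo(1) R(1) g'(1)]
            T_assoc[OF S(3) lo(3) g(1)] T_assoc[OF S(3) lo(3) g'(1)] R g g' eq by simp
      qed
      moreover have "g \<bullet> ?r k = g' \<bullet> ?r k"
      proof (rule cocart_cancel[OF lZ])
        show "g \<bullet> ?r k \<in> over (Id B (pOb Q)) (push w Z) Q" "g' \<bullet> ?r k \<in> over (Id B (pOb Q)) (push w Z) Q"
          using over_comp[OF R(3) g(1)] over_comp[OF R(3) g'(1)] w by auto
        show "(g \<bullet> ?r k) \<bullet> lift w Z = (g' \<bullet> ?r k) \<bullet> lift w Z"
          using T_assoc[OF lo(2) R(3) g(1)] T_assoc[OF lo(2) R(3) g'(1)]
            T_assoc[OF S(4) lo(3) g(1)] T_assoc[OF S(4) lo(3) g'(1)] R g g' eq by simp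
      qed
      ultimately show "Comp (fib (pOb Q)) g (?r j) = Comp (fib (pOb Q)) g' (?r j)"
        "Comp (fib (pOb Q)) g (?r k) = Comp (fib (pOb Q)) g' (?r k)" by auto
    qed (use g g' overD[OF R(1)] in auto)
    then show "h = h'" using g g' by simp
  qed (use S in \<open>auto simp: over_def\<close>)
qed

text \<open>The span \<open>(i, f)\<close> is moved along the cocartesian arrows \<open>lX\<close>, \<open>lY\<close>, \<open>lZ\<close> to the span \<open>(i1, f1)\<close> in
  the fiber over the base pushout \<open>(jB, kB)\<close>; the resulting square in \<open>T\<close> is \<open>(j1 \<bullet> lY, k1 \<bullet> lZ)\<close>.\<close>

definition glued ::
  "'m \<Rightarrow> 'm \<Rightarrow> 'b \<Rightarrow> 'b \<Rightarrow> 'm \<Rightarrow> 'm \<Rightarrow> 'm \<Rightarrow> 'm \<Rightarrow> 'm \<Rightarrow> 'm \<Rightarrow> 'm \<Rightarrow> bool" where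
  "glued i f jB kB lX lY lZ i1 f1 j1 k1 \<longleftrightarrow>
     i \<in> Mor T \<and> f \<in> Mor T \<and> Dom T f = Dom T i \<and>
     is_pushout B (pMor i) (pMor f) jB kB \<and>
     lX \<in> cocart (jB \<star> pMor i) (Dom T i) (Dom T i1) \<and> lY \<in> cocart jB (Cod T i) (Cod T i1) \<and>
     lZ \<in> cocart kB (Cod T f) (Cod T f1) \<and>
     i1 \<bullet> lX = lY \<bullet> i \<and> f1 \<bullet> lX = lZ \<bullet> f \<and>
     i1 \<in> cof (Cod B jB) \<and> is_pushout (fib (Cod B jB)) i1 f1 j1 k1"

lemma gluedD:
  assumes "glued i f jB kB lX lY lZ i1 f1 j1 k1"
  shows "i \<in> over (pMor i) (Dom T i) (Cod T i)" "f \<in> over (pMor f) (Dom T i) (Cod T f)"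
    "is_pushout B (pMor i) (pMor f) jB kB"
    "lX \<in> cocart (jB \<star> pMor i) (Dom T i) (Dom T i1)" "lY \<in> cocart jB (Cod T i) (Cod T i1)"
    "lZ \<in> cocart kB (Cod T f) (Cod T f1)"
    "i1 \<bullet> lX = lY \<bullet> i" "f1 \<bullet> lX = lZ \<bullet> f" "i1 \<in> cof (Cod B jB)"
    "is_pushout (fib (Cod B jB)) i1 f1 j1 k1"
    "i1 \<in> over (Id B (Cod B jB)) (Dom T i1) (Cod T i1)"
    "f1 \<in> over (Id B (Cod B jB)) (Dom T i1) (Cod T f1)"
    "j1 \<in> over (Id B (Cod B jB)) (Cod T i1) (Cod T j1)"
    "k1 \<in> over (Id B (Cod B jB)) (Cod T f1) (Cod T j1)"
    "j1 \<bullet> i1 = k1 \<bullet> f1"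
    "Cod B jB \<in> Ob B" "jB \<star> pMor i = kB \<star> pMor f"
    "pOb (Dom T i1) = Cod B jB" "pOb (Cod T i1) = Cod B jB" "pOb (Cod T f1) = Cod B jB"
    "pOb (Cod T j1) = Cod B jB"
    "j1 \<bullet> lY \<in> over jB (Cod T i) (Cod T j1)" "k1 \<bullet> lZ \<in> over kB (Cod T f) (Cod T j1)"
proof -
  show 0: "is_pushout B (pMor i) (pMor f) jB kB"
    "lX \<in> cocart (jB \<star> pMor i) (Dom T i) (Dom T i1)" "lY \<in> cocart jB (Cod T i) (Cod T i1)"
    "lZ \<in> cocart kB (Cod T f) (Cod T f1)"
    "i1 \<bullet> lX = lY \<bullet> i" "f1 \<bullet> lX = lZ \<bullet> f" "i1 \<in> cof (Cod B jB)"
    "is_pushout (fib (Cod B jB)) i1 f1 j1 k1"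
    and "i \<in> over (pMor i) (Dom T i) (Cod T i)" "f \<in> over (pMor f) (Dom T i) (Cod T f)"
    using assms overI[of i] overI[of f] by (auto simp: glued_def)
  show 1: "i1 \<in> over (Id B (Cod B jB)) (Dom T i1) (Cod T i1)"
    "f1 \<in> over (Id B (Cod B jB)) (Dom T i1) (Cod T f1)"
    "j1 \<in> over (Id B (Cod B jB)) (Cod T i1) (Cod T j1)"
    "k1 \<in> over (Id B (Cod B jB)) (Cod T f1) (Cod T j1)"
    "j1 \<bullet> i1 = k1 \<bullet> f1"
    using fiber_pushoutD[OF 0(8)] by auto
  show 2: "Cod B jB \<in> Ob B" "jB \<star> pMor i = kB \<star> pMor f"
    using 0(1) target.cod_in_Ob by (auto simp: is_pushout_def hom_def)
  show 3: "pOb (Dom T i1) = Cod B jB" "pOb (Cod T i1) = Cod B jB" "pOb (Cod T f1) = Cod B jB"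
    "pOb (Cod T j1) = Cod B jB"
    using over_vertical[OF _ 2(1)] 1 by blast+
  show "j1 \<bullet> lY \<in> over jB (Cod T i) (Cod T j1)" "k1 \<bullet> lZ \<in> over kB (Cod T f) (Cod T j1)"
    using over_comp_vertical[OF cocart_over[OF 0(3)]] over_comp_vertical[OF cocart_over[OF 0(4)]] 1 3
    by simp_all
qed

text \<open>The base pushout determines the arrow \<open>w\<close> over which a mediating arrow must
  lie; cocartesianness of \<open>lY\<close> and \<open>lZ\<close> extends the legs of a cocone over
  \<open>w\<close>; the fiber square, a pushout in \<open>T\<close> as well, then provides the arrow
  itself.\<close>

lemma glued_pushout:
  assumes G: "glued i f jB kB lX lY lZ i1 f1 j1 k1"
  shows "is_pushout T i f (j1 \<bullet> lY) (k1 \<bullet> lZ)"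
proof -
  note g = gluedD[OF G]
  define X Y Z P where "X = Dom T i" "Y = Cod T i" "Z = Cod T f" "P = Cod T j1"
  define X1 Y1 Z1 where "X1 = Dom T i1" "Y1 = Cod T i1" "Z1 = Cod T f1"
  note g = g[folded X_Y_Z_P_def X1_Y1_Z1_def]
  note lo = cocart_over[OF g(4)] cocart_over[OF g(5)] cocart_over[OF g(6)]
  have poT: "is_pushout T i1 f1 j1 k1" by (rule fiber_pushout_is_pushout[OF g(16,9,10)])
  show ?thesis
  proof (rule source.is_pushoutI[of i X Y f Z "j1 \<bullet> lY" P "k1 \<bullet> lZ"])
    show "(j1 \<bullet> lY) \<bullet> i = (k1 \<bullet> lZ) \<bullet> f"
      using T_assoc[OF g(1) lo(2) g(13)] T_assoc[OF g(2) lo(3) g(14)]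
        T_assoc[OF lo(1) g(11) g(13)] T_assoc[OF lo(1) g(12) g(14)] g(7,8,15) by simp
  next
    fix Q j' k'
    assume j': "j' \<in> hom T Y Q" and k': "k' \<in> hom T Z Q" and eq: "j' \<bullet> i = k' \<bullet> f"
    have j'o: "j' \<in> over (pMor j') Y Q" and k'o: "k' \<in> over (pMor k') Z Q"
      using j' k' by (auto simp: over_def)
    have "pMor j' \<star> pMor i = pMor k' \<star> pMor f"
      using arg_cong[OF eq, of pMor] overD[OF j'o] overD[OF k'o] overD[OF g(1)] overD[OF g(2)] by simp
    then obtain w where w: "w \<in> hom B (Cod B jB) (pOb Q)" "w \<star> jB = pMor j'" "w \<star> kB = pMor k'"
      using target.pushout_universal[OF g(3), of "pMor j'" "pOb Q" "pMor k'"]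
        overD[OF j'o] overD[OF k'o] overD[OF g(1)] overD[OF g(2)] by (auto simp: hom_def)
    have w': "w \<in> Mor B" "Dom B w = Cod B jB" using w by (auto simp: hom_def)
    obtain J where J: "J \<in> over w Y1 Q" "J \<bullet> lY = j'"
      using cocart_factor[OF g(5) j'o w(2)[symmetric] w'(1)] w' g(19) by auto
    obtain K where K: "K \<in> over w Z1 Q" "K \<bullet> lZ = k'"
      using cocart_factor[OF g(6) k'o w(3)[symmetric] w'(1)] w' g(20) by auto
    \<comment> \<open>Cancelling \<open>lX\<close>, which lies over the diagonal of the base square,
      reduces compatibility of the extended legs to the original cocone equation.\<close>
    have "J \<bullet> i1 = K \<bullet> f1"
    proof (rule cocart_cancel[OF g(4)])
      show "J \<bullet> i1 \<in> over w X1 Q" "K \<bullet> f1 \<in> over w X1 Q"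
        using over_comp_vertical'[OF _ J(1)] over_comp_vertical'[OF _ K(1)] g(11,12,18) by simp_all
      show "(J \<bullet> i1) \<bullet> lX = (K \<bullet> f1) \<bullet> lX"
        using T_assoc[OF lo(1) g(11) J(1)] T_assoc[OF lo(1) g(12) K(1)]
          T_assoc[OF g(1) lo(2) J(1)] T_assoc[OF g(2) lo(3) K(1)] g(7,8) J K eq by simp
    qed
    then obtain h where h: "h \<in> hom T P Q" "h \<bullet> j1 = J" "h \<bullet> k1 = K"
      using source.pushout_universal[OF poT, of J Q K] overD[OF J(1)] overD[OF K(1)]
      by (auto simp: hom_def X_Y_Z_P_def X1_Y1_Z1_def)
    have ho: "h \<in> over (pMor h) P Q" using h by (simp add: over_def)
    have "h \<bullet> j1 \<bullet> lY = j'" "h \<bullet> k1 \<bullet> lZ = k'"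
      using T_assoc[OF lo(2) g(13) ho] T_assoc[OF lo(3) g(14) ho] h J K by simp_all
    with h show "\<exists>h. h \<in> hom T P Q \<and> h \<bullet> j1 \<bullet> lY = j' \<and> h \<bullet> k1 \<bullet> lZ = k'" by blast
  next
    fix Q h h'
    assume h: "h \<in> hom T P Q" "h' \<in> hom T P Q"
      and eq: "h \<bullet> j1 \<bullet> lY = h' \<bullet> j1 \<bullet> lY" "h \<bullet> k1 \<bullet> lZ = h' \<bullet> k1 \<bullet> lZ"
    define w where "w = pMor h"
    have ho: "h \<in> over w P Q" "h' \<in> over (pMor h') P Q" using h by (auto simp: over_def w_def)
    note hD = overD[OF ho(1)] overD[OF ho(2)] overD[OF g(22)] overD[OF g(23)]
    \<comment> \<open>Cancelling \<open>lY\<close> and \<open>lZ\<close> presupposes a common base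
      arrow; cancellation for the base pushout provides it.\<close>
    have "w = pMor h'"
      by (rule target.pushout_unique_arrow[OF g(3), of _ "pOb Q"])
        (use arg_cong[OF eq(1), of pMor] arg_cong[OF eq(2), of pMor] hD in \<open>auto simp: hom_def\<close>)
    then have ho': "h' \<in> over w P Q" using ho(2) by simp
    have "h \<bullet> j1 = h' \<bullet> j1"
    proof (rule cocart_cancel[OF g(5)])
      show "h \<bullet> j1 \<in> over w Y1 Q" "h' \<bullet> j1 \<in> over w Y1 Q"
        using over_comp_vertical'[OF _ ho(1)] over_comp_vertical'[OF _ ho'] g(13,19) by simp_all
      show "(h \<bullet> j1) \<bullet> lY = (h' \<bullet> j1) \<bullet> lY"
        using T_assoc[OF lo(2) g(13) ho(1)] T_assoc[OF lo(2) g(13) ho'] eq by simp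
    qed
    moreover have "h \<bullet> k1 = h' \<bullet> k1"
    proof (rule cocart_cancel[OF g(6)])
      show "h \<bullet> k1 \<in> over w Z1 Q" "h' \<bullet> k1 \<in> over w Z1 Q"
        using over_comp_vertical'[OF _ ho(1)] over_comp_vertical'[OF _ ho'] g(14,20) by simp_all
      show "(h \<bullet> k1) \<bullet> lZ = (h' \<bullet> k1) \<bullet> lZ"
        using T_assoc[OF lo(3) g(14) ho(1)] T_assoc[OF lo(3) g(14) ho'] eq by simp
    qed
    ultimately show "h = h'"
      using source.pushout_unique_arrow[OF poT, of h Q h'] h by (simp add: X_Y_Z_P_def)
  qed (use g(1,2,22,23) in \<open>auto simp: over_def\<close>)
qed

text \<open>By base change the fiber condition on \<open>i\<close> makes \<open>i1\<close> a
  cofibration of the fiber over the corner of the base pushout, where (C3) applies to the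
  transported span.\<close>

lemma glued_exists:
  assumes po: "is_pushout B (pMor i) (pMor f) jB kB"
    and i: "i \<in> Mor T" "cof.vert i" and f: "f \<in> Mor T" "Dom T f = Dom T i"
  obtains lX lY lZ i1 f1 j1 k1 where "glued i f jB kB lX lY lZ i1 f1 j1 k1" "k1 \<in> cof (Cod B jB)"
proof -
  define X Y Z A where "X = Dom T i" "Y = Cod T i" "Z = Cod T f" "A = Cod B jB"
  have io: "i \<in> over (pMor i) X Y" and fo: "f \<in> over (pMor f) X Z"
    using overI[OF i(1)] overI[OF f(1)] f(2) by (simp_all add: X_Y_Z_A_def)
  note iD = overD[OF io] and fD = overD[OF fo]
  have jB: "jB \<in> Mor B" "Dom B jB = pOb Y" "Cod B jB = A" and kB: "kB \<in> Mor B" "Dom B kB = pOb Z" "Cod B kB = A"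
    and sq: "jB \<star> pMor i = kB \<star> pMor f"
    using po iD fD by (auto simp: is_pushout_def hom_def X_Y_Z_A_def(4))
  have A: "A \<in> Ob B" using jB target.cod_in_Ob by blast
  interpret F: waldhausen_category "fib A" "cof A" "weq A" using fiber_waldhausen[OF A] .
  have d: "jB \<star> pMor i \<in> Mor B" "Dom B (jB \<star> pMor i) = pOb X" "Cod B (jB \<star> pMor i) = A"
    using jB iD by auto
  \<comment> \<open>The lift at \<open>X\<close> is taken over the diagonal of the base square, so
    that both legs of the span factor through the same cocartesian arrow.\<close>
  obtain lX X1 where lX: "lX \<in> cocart (jB \<star> pMor i) X X1" using lift_cocart d iD by blast
  obtain lY Y1 where lY: "lY \<in> cocart jB Y Y1" using lift_cocart jB iD by blast
  obtain lZ Z1 where lZ: "lZ \<in> cocart kB Z Z1" using lift_cocart kB fD by blast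
  note lo = cocart_over[OF lX] cocart_over[OF lY] cocart_over[OF lZ]
  note lXD = overD[OF lo(1)] and lYD = overD[OF lo(2)] and lZD = overD[OF lo(3)]
  have p1: "pOb X1 = A" "pOb Y1 = A" "pOb Z1 = A" using lXD lYD lZD jB kB d by auto
  obtain i1 where i1: "i1 \<in> over (Id B A) X1 Y1" "i1 \<bullet> lX = lY \<bullet> i"
    using cocart_factor_vertical[OF lX over_comp[OF io lo(2)]] p1 by auto
  have "kB \<star> pMor f = jB \<star> pMor i" using sq by simp
  then have "lZ \<bullet> f \<in> over (jB \<star> pMor i) X Z1" using over_comp[OF fo lo(3)] by simp
  then obtain f1 where f1: "f1 \<in> over (Id B A) X1 Z1" "f1 \<bullet> lX = lZ \<bullet> f"
    using cocart_factor_vertical[OF lX] p1 by auto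
  note i1D = overD[OF i1(1)] and f1D = overD[OF f1(1)]
  have "cof.vert i1" by (rule cof.vert_base_change[OF io i(2) lX lY i1])
  then have i1c: "i1 \<in> cof A" using cof.vert_fiber_iff[OF i1(1) A] by simp
  obtain j1 k1 where jk: "is_pushout (fib A) i1 f1 j1 k1" "k1 \<in> cof A"
    using F.cof_pushout[OF i1c, of f1] i1D f1D by auto
  have "glued i f jB kB lX lY lZ i1 f1 j1 k1"
    using i(1) f(1) f(2)[folded X_Y_Z_A_def] po lX lY lZ i1(2) f1(2) i1c jk(1)
    unfolding glued_def X_Y_Z_A_def[symmetric] i1D(2,3) f1D(3) by blast
  with that jk show thesis by (simp add: X_Y_Z_A_def)
qed

section \<open>The gluing lemma for the constructed pushouts\<close>

text \<open>With \<open>w\<close> the base image of \<open>h\<close>, the three weak equivalences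
  extend over \<open>w\<close> to the transported spans. Splitting them and \<open>h\<close> at the
  chosen lifts along \<open>w\<close> leaves a diagram in the fiber over \<open>A'\<close>, from the
  reindexed first pushout to the second, to which gluing in that fiber applies.\<close>

lemma glued_gluing:
  assumes G: "glued i f jB kB lX lY lZ i1 f1 j1 k1"
    and G': "glued i' f' jB' kB' lX' lY' lZ' i1' f1' j1' k1'"
    and abc: "weq.vert a" "weq.vert b" "weq.vert c"
    and ah: "a \<in> hom T (Dom T i) (Dom T i')" and bh: "b \<in> hom T (Cod T i) (Cod T i')"
    and ch: "c \<in> hom T (Cod T f) (Cod T f')" and hh: "h \<in> hom T (Cod T j1) (Cod T j1')"
    and bi: "b \<bullet> i = i' \<bullet> a" and cf: "c \<bullet> f = f' \<bullet> a"
    and hj: "h \<bullet> j1 \<bullet> lY = (j1' \<bullet> lY') \<bullet> b" and hk: "h \<bullet> k1 \<bullet> lZ = (k1' \<bullet> lZ') \<bullet> c"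
  shows "weq.vert h"
proof -
  define X Y Z P where "X = Dom T i" "Y = Cod T i" "Z = Cod T f" "P = Cod T j1"
  define X1 Y1 Z1 where "X1 = Dom T i1" "Y1 = Cod T i1" "Z1 = Cod T f1"
  define X' Y' Z' P' where "X' = Dom T i'" "Y' = Cod T i'" "Z' = Cod T f'" "P' = Cod T j1'"
  define X1' Y1' Z1' where "X1' = Dom T i1'" "Y1' = Cod T i1'" "Z1' = Cod T f1'"
  define w A A' where "w = pMor h" "A = Cod B jB" "A' = Cod B jB'"
  note g = gluedD[OF G, folded X_Y_Z_P_def X1_Y1_Z1_def w_A_A'_def]
  note g' = gluedD[OF G', folded X'_Y'_Z'_P'_def X1'_Y1'_Z1'_def w_A_A'_def]
  have ao: "a \<in> over (pMor a) X X'" and bo: "b \<in> over (pMor b) Y Y'"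
    and co: "c \<in> over (pMor c) Z Z'" and ho: "h \<in> over w P P'"
    using ah bh ch hh unfolding over_def X_Y_Z_P_def X'_Y'_Z'_P'_def w_A_A'_def by auto
  note hD = overD[OF ho]
  have w: "w \<in> Mor B" "Dom B w = A" "Cod B w = A'" using hD g(21) g'(21) by auto
  note lo = cocart_over[OF g(4)] cocart_over[OF g(5)] cocart_over[OF g(6)]
  note lo' = cocart_over[OF g'(4)] cocart_over[OF g'(5)] cocart_over[OF g'(6)]
  have wj: "w \<star> jB = jB' \<star> pMor b"
    using arg_cong[OF hj, of pMor] overD[OF g(22)] overD[OF g'(22)] overD[OF bo] hD by simp
  have wk: "w \<star> kB = kB' \<star> pMor c"
    using arg_cong[OF hk, of pMor] overD[OF g(23)] overD[OF g'(23)] overD[OF co] hD by simp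
  have pbi: "pMor b \<star> pMor i = pMor i' \<star> pMor a"
    using arg_cong[OF bi, of pMor] overD[OF bo] overD[OF ao] overD[OF g(1)] overD[OF g'(1)] by simp
  \<comment> \<open>The corner \<open>a\<close> is transported along arrows over the diagonals of
    the two base squares, so its base compatibility arises by pasting the square for
    \<open>b\<close> with the image of \<open>bi\<close>.\<close>
  have wi: "w \<star> jB \<star> pMor i = (jB' \<star> pMor i') \<star> pMor a"
  proof -
    have "w \<star> jB \<star> pMor i = (w \<star> jB) \<star> pMor i"
      using target.assoc[of "pMor i" jB w] overD(7-9)[OF lo(2)] overD(7-9)[OF g(1)] w g(19) by simp
    also have "\<dots> = jB' \<star> pMor b \<star> pMor i"
      unfolding wj using target.assoc[of "pMor i" "pMor b" jB'] overD(7-9)[OF lo'(2)]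
        overD(7-9)[OF bo] overD(7-9)[OF g(1)] by simp
    also have "\<dots> = (jB' \<star> pMor i') \<star> pMor a"
      unfolding pbi using target.assoc[of "pMor a" "pMor i'" jB'] overD(7-9)[OF lo'(2)]
        overD(7-9)[OF ao] overD(7-9)[OF g'(1)] by simp
    finally show ?thesis .
  qed
  have wd: "Dom B w = pOb X1" "Dom B w = pOb Y1" "Dom B w = pOb Z1" using w g(18-20) by simp_all
  \<comment> \<open>\<open>a1\<close>, \<open>b1\<close>, \<open>c1\<close> compare the transported
    spans over \<open>w\<close>; \<open>a2\<close>, \<open>b2\<close>, \<open>c2\<close> are their
    fiber parts, weak equivalences over \<open>A'\<close>.\<close>
  obtain a1 a2 where a1: "a1 \<in> over w X1 X1'" "a1 \<bullet> lX = lX' \<bullet> a"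
    and a2: "a2 \<in> over (Id B A') (push w X1) X1'" "a2 \<bullet> lift w X1 = a1" "a2 \<in> weq A'"
    using weq.vert_extend[OF ao abc(1) g(4) g'(4) w(1) wd(1) wi] unfolding g'(18) .
  obtain b1 b2 where b1: "b1 \<in> over w Y1 Y1'" "b1 \<bullet> lY = lY' \<bullet> b"
    and b2: "b2 \<in> over (Id B A') (push w Y1) Y1'" "b2 \<bullet> lift w Y1 = b1" "b2 \<in> weq A'"
    using weq.vert_extend[OF bo abc(2) g(5) g'(5) w(1) wd(2) wj] unfolding g'(19) .
  obtain c1 c2 where c1: "c1 \<in> over w Z1 Z1'" "c1 \<bullet> lZ = lZ' \<bullet> c"
    and c2: "c2 \<in> over (Id B A') (push w Z1) Z1'" "c2 \<bullet> lift w Z1 = c1" "c2 \<in> weq A'"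
    using weq.vert_extend[OF co abc(3) g(6) g'(6) w(1) wd(3) wk] unfolding g'(20) .
  have m: "lift w X1 \<in> cocart w X1 (push w X1)" "lift w Y1 \<in> cocart w Y1 (push w Y1)"
    "lift w Z1 \<in> cocart w Z1 (push w Z1)" "lift w P \<in> cocart w P (push w P)"
    using lift_cocart[OF w(1) _ wd(1)] lift_cocart[OF w(1) _ wd(2)] lift_cocart[OF w(1) _ wd(3)]
      lift_cocart[OF w(1) _ hD(8)] overD(6)[OF lo(1)] overD(6)[OF lo(2)] overD(6)[OF lo(3)] hD(5)
    by blast+
  note mo = m[THEN cocart_over]
  have pP: "pOb (push w P) = A'" "pOb P' = A'" using overD(9)[OF mo(4)] w g'(21) by simp_all
  \<comment> \<open>\<open>h2\<close> is the fiber part of \<open>h\<close>; by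
    \<open>vert_iff\<close> it decides the goal.\<close>
  obtain h2 where h2: "h2 \<in> over (Id B A') (push w P) P'" "h2 \<bullet> lift w P = h"
    using cocart_factor_vertical[OF m(4) ho] unfolding pP .
  let ?r = "on_Mor (reidx w)"
  have R: "?r i1 \<in> over (Id B A') (push w X1) (push w Y1)" "?r i1 \<bullet> lift w X1 = lift w Y1 \<bullet> i1"
    "?r f1 \<in> over (Id B A') (push w X1) (push w Z1)" "?r f1 \<bullet> lift w X1 = lift w Z1 \<bullet> f1"
    "?r j1 \<in> over (Id B A') (push w Y1) (push w P)" "?r j1 \<bullet> lift w Y1 = lift w P \<bullet> j1"
    "?r k1 \<in> over (Id B A') (push w Z1) (push w P)" "?r k1 \<bullet> lift w Z1 = lift w P \<bullet> k1"
    using reindex_props[of i1 X1 Y1 w] reindex_props[of f1 X1 Z1 w] reindex_props[of j1 Y1 P w]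
      reindex_props[of k1 Z1 P w] g(11-14,18-20) w by auto
  have idA': "Id B A' \<star> Id B A' = Id B A'" "Id B A' \<star> w = w" "w \<star> Id B A = w"
    using w g(16) g'(16) by auto

  \<comment> \<open>This and the next three equations compare the two transported squares. Each is
    checked after a cocartesian arrow out of an original corner, where it reduces to a hypothesis on
    \<open>h\<close>, \<open>b\<close> or \<open>c\<close>.\<close>
  have hj1: "h \<bullet> j1 = j1' \<bullet> b1"
  proof (rule cocart_cancel[OF g(5)])
    show "h \<bullet> j1 \<in> over w Y1 P'" "j1' \<bullet> b1 \<in> over w Y1 P'"
      using over_comp[OF g(13) ho] over_comp[OF b1(1) g'(13)] idA' by simp_all
    show "(h \<bullet> j1) \<bullet> lY = (j1' \<bullet> b1) \<bullet> lY"
      using T_assoc[OF lo(2) g(13) ho] T_assoc[OF lo(2) b1(1) g'(13)] T_assoc[OF bo lo'(2) g'(13)]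
        hj b1(2) by simp
  qed
  have hk1: "h \<bullet> k1 = k1' \<bullet> c1"
  proof (rule cocart_cancel[OF g(6)])
    show "h \<bullet> k1 \<in> over w Z1 P'" "k1' \<bullet> c1 \<in> over w Z1 P'"
      using over_comp[OF g(14) ho] over_comp[OF c1(1) g'(14)] idA' by simp_all
    show "(h \<bullet> k1) \<bullet> lZ = (k1' \<bullet> c1) \<bullet> lZ"
      using T_assoc[OF lo(3) g(14) ho] T_assoc[OF lo(3) c1(1) g'(14)] T_assoc[OF co lo'(3) g'(14)]
        hk c1(2) by simp
  qed
  have bi1: "b1 \<bullet> i1 = i1' \<bullet> a1"
  proof (rule cocart_cancel[OF g(4)])
    show "b1 \<bullet> i1 \<in> over w X1 Y1'" "i1' \<bullet> a1 \<in> over w X1 Y1'"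
      using over_comp[OF g(11) b1(1)] over_comp[OF a1(1) g'(11)] idA' by simp_all
    have "(b1 \<bullet> i1) \<bullet> lX = b1 \<bullet> lY \<bullet> i" using T_assoc[OF lo(1) g(11) b1(1)] g(7) by simp
    also have "\<dots> = lY' \<bullet> i' \<bullet> a"
      using T_assoc[OF g(1) lo(2) b1(1)] T_assoc[OF g(1) bo lo'(2)] b1(2) bi by simp
    also have "\<dots> = i1' \<bullet> lX' \<bullet> a"
      using T_assoc[OF ao g'(1) lo'(2)] T_assoc[OF ao lo'(1) g'(11)] g'(7) by simp
    also have "\<dots> = (i1' \<bullet> a1) \<bullet> lX" using T_assoc[OF lo(1) a1(1) g'(11)] a1(2) by simp
    finally show "(b1 \<bullet> i1) \<bullet> lX = (i1' \<bullet> a1) \<bullet> lX" .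
  qed
  have cf1: "c1 \<bullet> f1 = f1' \<bullet> a1"
  proof (rule cocart_cancel[OF g(4)])
    show "c1 \<bullet> f1 \<in> over w X1 Z1'" "f1' \<bullet> a1 \<in> over w X1 Z1'"
      using over_comp[OF g(12) c1(1)] over_comp[OF a1(1) g'(12)] idA' by simp_all
    have "(c1 \<bullet> f1) \<bullet> lX = c1 \<bullet> lZ \<bullet> f" using T_assoc[OF lo(1) g(12) c1(1)] g(8) by simp
    also have "\<dots> = lZ' \<bullet> f' \<bullet> a"
      using T_assoc[OF g(2) lo(3) c1(1)] T_assoc[OF g(2) co lo'(3)] c1(2) cf by simp
    also have "\<dots> = f1' \<bullet> lX' \<bullet> a"
      using T_assoc[OF ao g'(2) lo'(3)] T_assoc[OF ao lo'(1) g'(12)] g'(8) by simp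
    also have "\<dots> = (f1' \<bullet> a1) \<bullet> lX" using T_assoc[OF lo(1) a1(1) g'(12)] a1(2) by simp
    finally show "(c1 \<bullet> f1) \<bullet> lX = (f1' \<bullet> a1) \<bullet> lX" .
  qed
  \<comment> \<open>Splitting the sides lying over \<open>w\<close> at the chosen lifts turns a
    square over \<open>w\<close> into one inside the fiber over \<open>A'\<close>, with its source
    edge reindexed. The form is general enough for all four edges.\<close>
  have reindexed: "t2 \<bullet> ?r s = s' \<bullet> t2'"
    if s: "s \<in> over (Id B A) U V" and rs: "?r s \<in> over (Id B A') (push w U) (push w V)"
      "?r s \<bullet> lift w U = lift w V \<bullet> s"
      and lU: "lift w U \<in> cocart w U (push w U)" and lV: "lift w V \<in> cocart w V (push w V)"
      and s': "s' \<in> over (Id B A') U' V'"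
      and t2: "t2 \<in> over (Id B A') (push w V) V'" "t2 \<bullet> lift w V = t"
      and t2': "t2' \<in> over (Id B A') (push w U) U'" "t2' \<bullet> lift w U = t'"
      and eq: "t \<bullet> s = s' \<bullet> t'"
    for s U V s' U' V' t2 t2' t t'
  proof (rule cocart_cancel[OF lU])
    show "t2 \<bullet> ?r s \<in> over (Id B A') (push w U) V'" "s' \<bullet> t2' \<in> over (Id B A') (push w U) V'"
      using over_comp[OF rs(1) t2(1)] over_comp[OF t2'(1) s'] idA' by simp_all
    show "(t2 \<bullet> ?r s) \<bullet> lift w U = (s' \<bullet> t2') \<bullet> lift w U"
      using T_assoc[OF cocart_over[OF lU] rs(1) t2(1)] T_assoc[OF cocart_over[OF lU] t2'(1) s']
        T_assoc[OF s cocart_over[OF lV] t2(1)] rs(2) t2(2) t2'(2) eq by simp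
  qed
  interpret F: waldhausen_category "fib A'" "cof A'" "weq A'" using fiber_waldhausen[OF g'(16)] .
  have po: "is_pushout (fib A') (?r i1) (?r f1) (?r j1) (?r k1)" and ri: "?r i1 \<in> cof A'"
    using exact_functor.preserves_pushout[OF reindex_exact[OF w(1)]]
      exact_functor.preserves_cof[OF reindex_exact[OF w(1)]] g(9,10) unfolding w by blast+
  note D = overD(2,3)[OF R(1)] overD(2,3)[OF R(3)] overD(2,3)[OF R(5)]
    overD(2,3)[OF g'(11)] overD(2,3)[OF g'(12)] overD(2,3)[OF g'(13)]
  have "h2 \<in> weq A'"
  proof (rule F.gluing[OF ri g'(9) po g'(10) a2(3) b2(3) c2(3)], unfold hom_fiber fiber_simps D)
    show "b2 \<bullet> ?r i1 = i1' \<bullet> a2"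
      by (rule reindexed[OF g(11) R(1,2) m(1,2) g'(11) b2(1,2) a2(1,2) bi1])
    show "c2 \<bullet> ?r f1 = f1' \<bullet> a2"
      by (rule reindexed[OF g(12) R(3,4) m(1,3) g'(12) c2(1,2) a2(1,2) cf1])
    show "h2 \<bullet> ?r j1 = j1' \<bullet> b2"
      by (rule reindexed[OF g(13) R(5,6) m(2,4) g'(13) h2 b2(1,2) hj1])
    show "h2 \<bullet> ?r k1 = k1' \<bullet> c2"
      by (rule reindexed[OF g(14) R(7,8) m(3,4) g'(14) h2 c2(1,2) hk1])
  qed (fact a2 b2 c2 h2)+
  then show ?thesis using weq.vert_iff[OF m(4), of h2 P' h, unfolded pP, OF h2] by (rule iffD2[rotated])
qed

section \<open>The initial object of the total category\<close>

text \<open>Take an initial object of the fiber over \<open>z\<close>. An arrow from it to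
  \<open>X\<close> lies over the unique \<open>u\<close> from \<open>z\<close> to
  \<open>pOb X\<close>, hence corresponds to a fiber arrow out of its reindexing along
  \<open>u\<close>, which is again initial by exactness.\<close>

lemma total_initial:
  assumes z: "is_initial B z" and zc: "\<forall>A \<in> Ob B. \<forall>u \<in> hom B z A. u \<in> cofB"
  shows "\<exists>Z. is_initial T Z \<and> (\<forall>X \<in> Ob T. \<forall>f \<in> hom T Z X. pMor f \<in> cofB \<and> cof.vert f)"
proof -
  have zB: "z \<in> Ob B" using z by (simp add: is_initial_def)
  interpret Fz: waldhausen_category "fib z" "cof z" "weq z" using fiber_waldhausen[OF zB] .
  obtain Z where Zi: "is_initial (fib z) Z" using Fz.cof_initial by blast
  then have Z: "Z \<in> Ob T" "pOb Z = z" by (auto simp: is_initial_def)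
  have key: "\<exists>!f. f \<in> hom T Z X" "\<forall>f \<in> hom T Z X. pMor f \<in> cofB \<and> cof.vert f"
    if X: "X \<in> Ob T" for X
  proof -
    have A: "pOb X \<in> Ob B" using X map_Ob by blast
    obtain u where u: "u \<in> hom B z (pOb X)" and uu: "\<And>v. v \<in> hom B z (pOb X) \<Longrightarrow> v = u"
      using z A unfolding is_initial_def by blast
    have u': "u \<in> Mor B" "Dom B u = z" "Cod B u = pOb X" using u by (auto simp: hom_def)
    interpret F: waldhausen_category "fib (pOb X)" "cof (pOb X)" "weq (pOb X)"
      using fiber_waldhausen[OF A] .
    have l: "lift u Z \<in> cocart u Z (push u Z)" using lift_cocart u' Z by simp
    have pp: "pOb (push u Z) = pOb X" using overD(9)[OF cocart_over[OF l]] u' by simp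
    have ini: "is_initial (fib (pOb X)) (push u Z)"
      using exact_functor.preserves_initial[OF reindex_exact[OF u'(1)], of Z] Zi u'
      by (simp add: reindex_def)
    moreover have "X \<in> Ob (fib (pOb X))" using X by simp
    ultimately have "\<exists>!q. q \<in> over (Id B (pOb X)) (push u Z) X"
      unfolding is_initial_def hom_fiber by blast
    then obtain q where q: "q \<in> over (Id B (pOb X)) (push u Z) X"
      and qq: "\<And>q'. q' \<in> over (Id B (pOb X)) (push u Z) X \<Longrightarrow> q' = q"
      by blast
    \<comment> \<open>\<open>push u Z\<close> is initial but not known to be the object singled out
      by (C2) in this fiber, hence the appeal to \<open>initial_cof\<close>.\<close>
    have qc: "q \<in> cof (pOb X)" using F.initial_cof[OF ini, of q X] q by simp
    have ql: "q \<bullet> lift u Z \<in> over u Z X"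
      using over_comp_vertical[OF cocart_over[OF l], of q X] q pp by simp
    have only: "f = q \<bullet> lift u Z" if f: "f \<in> hom T Z X" for f
    proof -
      have "pMor f = u" using uu[of "pMor f"] map_hom[OF f] Z by simp
      then have "f \<in> over u Z X" using f by (simp add: over_def)
      then show ?thesis using cocart_factor_vertical[OF l] qq unfolding pp by blast
    qed
    have qlh: "q \<bullet> lift u Z \<in> hom T Z X" "pMor (q \<bullet> lift u Z) = u" using ql by (auto simp: over_def)
    show "\<exists>!f. f \<in> hom T Z X" using only qlh by blast
    have "cof.vert (q \<bullet> lift u Z)" using cof.vert_iff[OF l q refl] qc by blast
    moreover have "u \<in> cofB" using zc A u by blast
    ultimately show "\<forall>f \<in> hom T Z X. pMor f \<in> cofB \<and> cof.vert f" using only qlh by metis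
  qed
  show ?thesis using key Z(1) unfolding is_initial_def by blast
qed

end

section \<open>The Waldhausen structure on the total category\<close>

theorem theorem1:
  fixes T :: "('o, 'm) cat" and B :: "('a, 'b) cat" and p :: "('o, 'm, 'a, 'b) functor_data"
    and push :: "'b \<Rightarrow> 'o \<Rightarrow> 'o" and lift :: "'b \<Rightarrow> 'o \<Rightarrow> 'm"
    and cof weq :: "'a \<Rightarrow> 'm set" and cofB weqB :: "'b set"
  assumes "waldhausen_opfibration T B p push lift cof weq"
    and "waldhausen_category B cofB weqB"
  shows "waldhausen_category T (total_class T B p push lift cofB cof)
                               (total_class T B p push lift weqB weq)"
proof -
  interpret waldhausen_opfibration T B p push lift cof weq by fact
  interpret WB: waldhausen_category B cofB weqB by fact
  let ?c = "total_class T B p push lift cofB cof" and ?w = "total_class T B p push lift weqB weq"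
  \<comment> \<open>Membership splits into a condition in the base and one in the fiber, to be
    verified separately.\<close>
  have c: "f \<in> ?c \<longleftrightarrow> f \<in> Mor T \<and> pMor f \<in> cofB \<and> cof.vert f" for f
    by (auto simp: total_class_def cof.vert_def)
  have w: "f \<in> ?w \<longleftrightarrow> f \<in> Mor T \<and> pMor f \<in> weqB \<and> weq.vert f" for f
    by (auto simp: total_class_def weq.vert_def)
  have p_iso: "is_iso B (pMor f)" if iso: "is_iso T f" for f
  proof -
    have f: "f \<in> Mor T" using iso by (simp add: is_iso_def)
    obtain g where "g \<in> hom T (Cod T f) (Dom T f)" "g \<bullet> f = Id T (Dom T f)" "f \<bullet> g = Id T (Cod T f)"
      using source.is_isoE[OF iso source.Mor_in_hom[OF f]] by blast
    then show ?thesis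
      using target.is_isoI[of "pMor f" _ _ "pMor g"] map_hom[OF source.Mor_in_hom[OF f]]
        map_hom[of g] map_comp[of f "Dom T f" "Cod T f" g] map_comp[of g "Cod T f" "Dom T f" f]
        map_id f source.Mor_in_hom[OF f] source.dom_in_Ob source.cod_in_Ob by metis
  qed
  have c_comp: "g \<bullet> f \<in> ?c" if "f \<in> ?c" "g \<in> ?c" "Dom T g = Cod T f" for f g
    using that WB.cof_comp[of "pMor f" "pMor g"] cof.vert_comp[of f "pMor f" "Dom T f" "Cod T f" g "pMor g" "Cod T g"] overI[of f] overI[of g] by (simp add: c)
  have w_comp: "g \<bullet> f \<in> ?w" if "f \<in> ?w" "g \<in> ?w" "Dom T g = Cod T f" for f g
    using that WB.weq_comp[of "pMor f" "pMor g"] weq.vert_comp[of f "pMor f" "Dom T f" "Cod T f" g "pMor g" "Cod T g"] overI[of f] overI[of g] by (simp add: w)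
  have c_iso: "f \<in> ?c" if "is_iso T f" for f
    using that p_iso WB.cof_iso cof.vert_iso by (simp add: c is_iso_def)
  have w_iso: "f \<in> ?w" if "is_iso T f" for f
    using that p_iso WB.weq_iso weq.vert_iso by (simp add: w is_iso_def)
  \<comment> \<open>(C3) in the base supplies the square over which the span is glued. Both
    cofibrations \<open>kB\<close> and \<open>k1\<close> are retained, as together they make
    \<open>k1 \<bullet> lZ\<close> a total cofibration.\<close>
  have glue_data: "\<exists>jB kB lX lY lZ i1 f1 j1 k1. glued i f jB kB lX lY lZ i1 f1 j1 k1 \<and>
      kB \<in> cofB \<and> k1 \<in> cof (Cod B jB)"
    if if_: "i \<in> ?c" "f \<in> Mor T" "Dom T f = Dom T i" for i f
  proof -
    obtain jB kB where "is_pushout B (pMor i) (pMor f) jB kB" "kB \<in> cofB"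
      using WB.cof_pushout[of "pMor i" "pMor f"] if_ by (auto simp: c)
    with glued_exists[of i f jB kB] if_ show ?thesis unfolding c by metis
  qed
  show ?thesis
  proof
    show "?c \<subseteq> Mor T" "?w \<subseteq> Mor T" using c w by auto
    obtain z where "is_initial B z" "\<forall>A \<in> Ob B. \<forall>u \<in> hom B z A. u \<in> cofB"
      using WB.cof_initial by blast
    from total_initial[OF this]
    show "\<exists>Z. is_initial T Z \<and> (\<forall>X \<in> Ob T. \<forall>f \<in> hom T Z X. f \<in> ?c)"
      unfolding c by (auto simp: hom_def)
  next
    fix i f assume if_: "i \<in> ?c" "f \<in> Mor T" "Dom T f = Dom T i"
    obtain jB kB lX lY lZ i1 f1 j1 k1 where G: "glued i f jB kB lX lY lZ i1 f1 j1 k1"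
      and kB: "kB \<in> cofB" and k1: "k1 \<in> cof (Cod B jB)"
      using glue_data[OF if_] by blast
    note g = gluedD[OF G]
    have "cof.vert (k1 \<bullet> lZ)"
      using cof.vert_iff[OF g(6), of k1 "Cod T j1" "k1 \<bullet> lZ"] g(14) k1 unfolding g(21) by blast
    then have "k1 \<bullet> lZ \<in> ?c" using overD[OF g(23)] kB by (simp add: c)
    with glued_pushout[OF G] show "\<exists>j k. is_pushout T i f j k \<and> k \<in> ?c" by blast
  next
    fix i i' f j k f' j' k' a b c0 h
    assume i: "i \<in> ?c" "i' \<in> ?c" and po: "is_pushout T i f j k" "is_pushout T i' f' j' k'"
      and abc: "a \<in> ?w" "b \<in> ?w" "c0 \<in> ?w"
      and ah: "a \<in> hom T (Dom T i) (Dom T i')" and bh: "b \<in> hom T (Cod T i) (Cod T i')"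
      and ch: "c0 \<in> hom T (Cod T f) (Cod T f')"
      and bi: "b \<bullet> i = i' \<bullet> a" and cf: "c0 \<bullet> f = f' \<bullet> a"
      and hh: "h \<in> hom T (Cod T j) (Cod T j')" and hj: "h \<bullet> j = j' \<bullet> b" and hk: "h \<bullet> k = k' \<bullet> c0"
    have f: "f \<in> Mor T" "Dom T f = Dom T i" "f' \<in> Mor T" "Dom T f' = Dom T i'"
      using po by (auto simp: is_pushout_def)
    obtain jB kB lX lY lZ i1 f1 j1 k1 where G: "glued i f jB kB lX lY lZ i1 f1 j1 k1"
      using glue_data[OF i(1) f(1,2)] by blast
    obtain jB' kB' lX' lY' lZ' i1' f1' j1' k1' where G': "glued i' f' jB' kB' lX' lY' lZ' i1' f1' j1' k1'"
      using glue_data[OF i(2) f(3,4)] by blast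
    note g = gluedD[OF G] and g' = gluedD[OF G']
    define J K J' K' where "J = j1 \<bullet> lY" "K = k1 \<bullet> lZ" "J' = j1' \<bullet> lY'" "K' = k1' \<bullet> lZ'"
    note JK = g(22,23)[folded J_K_J'_K'_def] g'(22,23)[folded J_K_J'_K'_def]
    have po0: "is_pushout T i f J K" "is_pushout T i' f' J' K'"
      using glued_pushout[OF G] glued_pushout[OF G'] unfolding J_K_J'_K'_def by auto
    \<comment> \<open>The given pushouts are arbitrary; comparison isomorphisms relate them to the
      glued ones.\<close>
    obtain s t where s: "s \<in> hom T (Cod T j) (Cod T J)" "s \<bullet> j = J" "s \<bullet> k = K"
      and t: "t \<in> hom T (Cod T J) (Cod T j)" "t \<bullet> J = j" "t \<bullet> K = k"
      and ts: "t \<bullet> s = Id T (Cod T j)" and st: "s \<bullet> t = Id T (Cod T J)"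
      using source.pushout_comparison[OF po(1) po0(1)] .
    obtain s' t' where s': "s' \<in> hom T (Cod T j') (Cod T J')" "s' \<bullet> j' = J'" "s' \<bullet> k' = K'"
      and t': "t' \<in> hom T (Cod T J') (Cod T j')" "t' \<bullet> J' = j'" "t' \<bullet> K' = k'"
      and ts': "t' \<bullet> s' = Id T (Cod T j')" and st': "s' \<bullet> t' = Id T (Cod T J')"
      using source.pushout_comparison[OF po(2) po0(2)] .
    have jk: "j \<in> hom T (Cod T i) (Cod T j)" "k \<in> hom T (Cod T f) (Cod T j)"
      "j' \<in> hom T (Cod T i') (Cod T j')" "k' \<in> hom T (Cod T f') (Cod T j')"
      using po by (auto simp: is_pushout_def)
    \<comment> \<open>Conjugating \<open>h\<close> by these isomorphisms gives the arrow induced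
      between the glued squares.\<close>
    define h0 where "h0 = s' \<bullet> h \<bullet> t"
    note homs = jk s(1) t(1) s'(1) t'(1) hh bh ch
    have h0: "h0 \<in> hom T (Cod T J) (Cod T J')"
      using homs by (auto simp: hom_def h0_def)
    have JM: "J \<in> Mor T" "Dom T J = Cod T i" "K \<in> Mor T" "Dom T K = Cod T f" "Cod T K = Cod T J"
      "Cod T J = Cod T j1" "Cod T J' = Cod T j1'"
      using overD(1-3)[OF JK(1)] overD(1-3)[OF JK(2)] overD(1-3)[OF JK(3)] by auto
    have h0J: "h0 \<bullet> J = J' \<bullet> b"
    proof -
      have "h0 \<bullet> J = s' \<bullet> h \<bullet> t \<bullet> J"
        unfolding h0_def using homs JM by (simp add: hom_def source.assoc)
      also have "\<dots> = (s' \<bullet> j') \<bullet> b"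
        unfolding t hj using homs by (simp add: hom_def source.assoc)
      finally show ?thesis by (simp add: s')
    qed
    have h0K: "h0 \<bullet> K = K' \<bullet> c0"
    proof -
      have "h0 \<bullet> K = s' \<bullet> h \<bullet> t \<bullet> K"
        unfolding h0_def using homs JM by (simp add: hom_def source.assoc)
      also have "\<dots> = (s' \<bullet> k') \<bullet> c0"
        unfolding t hk using homs by (simp add: hom_def source.assoc)
      finally show ?thesis by (simp add: s')
    qed
    have h0j: "h0 \<in> hom T (Cod T j1) (Cod T j1')" using h0 JM by simp
    have v: "weq.vert h0"
      by (rule glued_gluing[OF G G' _ _ _ ah bh ch h0j bi cf])
        (use abc h0J h0K in \<open>auto simp: w J_K_J'_K'_def\<close>)
    \<comment> \<open>The glued squares lie over base pushouts, so gluing in the base applies to the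
      image of \<open>h0\<close>.\<close>
    have "pMor h0 \<in> weqB"
    proof (rule WB.gluing[OF _ _ g(3) g'(3), of "pMor a" "pMor b" "pMor c0"])
      show "pMor i \<in> cofB" "pMor i' \<in> cofB" "pMor a \<in> weqB" "pMor b \<in> weqB" "pMor c0 \<in> weqB"
        using i abc by (auto simp: c w)
      note D = overD(1-4)[OF JK(1)] overD(1-4)[OF JK(2)] overD(1-4)[OF JK(3)] overD(1-4)[OF JK(4)]
      have M: "i \<in> Mor T" "i' \<in> Mor T" using i by (auto simp: c)
      show "pMor a \<in> hom B (Dom B (pMor i)) (Dom B (pMor i'))"
        "pMor b \<in> hom B (Cod B (pMor i)) (Cod B (pMor i'))"
        "pMor c0 \<in> hom B (Cod B (pMor f)) (Cod B (pMor f'))"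
        using ah bh ch M f by (auto simp: hom_def)
      show "pMor h0 \<in> hom B (Cod B jB) (Cod B jB')"
        using h0j g(21) g'(21) by (auto simp: hom_def)
      show "pMor b \<star> pMor i = pMor i' \<star> pMor a" "pMor c0 \<star> pMor f = pMor f' \<star> pMor a"
        using arg_cong[OF bi, of pMor] arg_cong[OF cf, of pMor] ah bh ch M f by (auto simp: hom_def)
      show "pMor h0 \<star> jB = jB' \<star> pMor b" "pMor h0 \<star> kB = kB' \<star> pMor c0"
        using arg_cong[OF h0J, of pMor] arg_cong[OF h0K, of pMor] D bh ch h0j by (auto simp: hom_def)
    qed
    with v h0 have "h0 \<in> ?w" by (auto simp: w hom_def)
    moreover have "s \<in> ?w" "t' \<in> ?w"
      using w_iso source.is_isoI[OF s(1) t(1) ts st] source.is_isoI[OF t'(1) s'(1) st' ts'] by auto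
    \<comment> \<open>Isomorphisms are total weak equivalences, so undoing the conjugation passes
      from \<open>h0\<close> back to \<open>h\<close>.\<close>
    ultimately have "t' \<bullet> h0 \<bullet> s \<in> ?w"
      using w_comp[of s h0] w_comp[of "h0 \<bullet> s" t'] homs h0 by (simp add: hom_def)
    also have "t' \<bullet> h0 \<bullet> s = (t' \<bullet> s') \<bullet> h \<bullet> (t \<bullet> s)"
      unfolding h0_def using homs by (simp add: hom_def source.assoc)
    also have "\<dots> = h" unfolding ts ts' using homs source.cod_in_Ob by (simp add: hom_def)
    finally show "h \<in> ?w" .
  qed (fact c_comp w_comp c_iso w_iso)+
qed

end
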